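(* Let $X\subset U\subset X^*$ be a Gelfand triple with a Hilbert space $U$ and a reflexive Banach space $X$ such that the imbedding is dense. Let $Y$ be a second Hilbert space and let $F:Y\to Y$, $G:X\to Y$, $T:X^*\to X$ be bounded linear operators such that $F=GTG^*$. Assume: (1) $G$ is compact with dense range in $Y$. (2) There exists $t\in[0,2\pi]$ such that $\mathrm{Re}(e^{it}T)=C+K$ with some compact operator $K$ and some self-adjoint and positive coercive operator $C$, i.e., there exists $c>0$ such that $\langle\varphi,C\varphi\rangle\ge c\|\varphi\|^2$ for all $\varphi\in X^*$. (3) $\mathrm{Im}\langle\varphi,T\varphi\rangle>0$ for all $\varphi\in\overline{\mathrm{Ran}(G^* )}$ with $\varphi\ne0$. Then the operator $F_\#:=|\mathrm{Re}(e^{it}F)|+\mathrm{Im}\,F$ is non-negative, and the ranges of $G:X\to Y$ and $F_\#^{1/2}:Y\to Y$ coincide: $$\mathrm{Ran}(G)=\mathrm{Ran}(F_\#^{1/2}).$$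
   Context: Here $Y$ is identified with its dual, $G^*:Y\to X^*$ is the adjoint of $G$, and $\langle\cdot,\cdot\rangle$ is the sesquilinear dual pairing between $X^*$ and $X$ extending the inner product of $U$, with the convention that it is linear in the second argument, so that $\mathrm{Im}\langle\varphi,T\varphi\rangle=\langle\varphi,(\mathrm{Im}\,T)\varphi\rangle$. The real and imaginary parts of an operator $A$ are the self-adjoint operators $\mathrm{Re}(A)=\frac{A+A^*}{2}$ and $\mathrm{Im}(A)=\frac{A-A^*}{2i}$. For a self-adjoint operator $A$ on $Y$, $|A|=(A^2)^{1/2}$. $C$ and $K$ map $X^*$ to $X$. $\mathrm{Ran}$ denotes the range and the bar denotes closure in $X^*$. *)

theory Defs
  imports "HOL-Analysis.Analysis"
begin

section \<open>Complex normed spaces and Hilbert spaces\<close>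

class complex_vector = real_vector +
  fixes scaleC :: "complex \<Rightarrow> 'a \<Rightarrow> 'a"  (infixr \<open>*\<^sub>C\<close> 75)
  assumes scaleC_add_right: "a *\<^sub>C (x + y) = a *\<^sub>C x + a *\<^sub>C y"
    and scaleC_add_left: "(a + b) *\<^sub>C x = a *\<^sub>C x + b *\<^sub>C x"
    and scaleC_scaleC: "a *\<^sub>C b *\<^sub>C x = (a * b) *\<^sub>C x"
    and scaleR_eq_scaleC: "r *\<^sub>R x = complex_of_real r *\<^sub>C x"

class complex_normed_vector = complex_vector + real_normed_vector +
  assumes norm_scaleC: "norm (a *\<^sub>C x) = cmod a * norm x"

class complex_banach = complex_normed_vector + banach

text \<open>The inner product is antilinear in the first and linear in the second argument.\<close>

class complex_inner = complex_normed_vector +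
  fixes cinner :: "'a \<Rightarrow> 'a \<Rightarrow> complex"
  assumes cinner_commute: "cinner x y = cnj (cinner y x)"
    and cinner_add_right: "cinner x (y + z) = cinner x y + cinner x z"
    and cinner_scaleC_right: "cinner x (a *\<^sub>C y) = a * cinner x y"
    and cinner_self_nonneg: "0 \<le> Re (cinner x x)"
    and norm_eq_sqrt_cinner: "norm x = sqrt (Re (cinner x x))"

class complex_hilbert = complex_inner + banach

definition bounded_clinear :: "('a::complex_normed_vector \<Rightarrow> 'b::complex_normed_vector) \<Rightarrow> bool" where
  "bounded_clinear A \<longleftrightarrow> bounded_linear A \<and> (\<forall>a x. A (a *\<^sub>C x) = a *\<^sub>C A x)"

definition compact_op :: "('a::complex_normed_vector \<Rightarrow> 'b::complex_normed_vector) \<Rightarrow> bool" where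
  "compact_op A \<longleftrightarrow> bounded_clinear A \<and> compact (closure (A ` cball 0 1))"


section \<open>The dual space\<close>

text \<open>
  The space \<open>X\<^sup>*\<close> is realised as the space of bounded antilinear functionals, with pointwise
  operations and the operator norm. This is the choice for which the embedding of a Hilbert space
  \<open>u \<mapsto> \<langle>\<cdot>, u\<rangle>\<close> and the adjoint \<open>G\<^sup>* : Y \<rightarrow> X\<^sup>*\<close> are complex linear, and for which the pairing
  below is linear in the second and antilinear in the first argument.
\<close>

typedef (overloaded) 'a adual =
  "{f :: 'a::complex_normed_vector \<Rightarrow>\<^sub>L complex. \<forall>a x. blinfun_apply f (a *\<^sub>C x) = cnj a * blinfun_apply f x}"
  by (rule exI[of _ 0]) simp

setup_lifting type_definition_adual

instantiation adual :: (complex_normed_vector) complex_normed_vector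
begin

lift_definition zero_adual :: "'a adual" is 0 by simp
lift_definition plus_adual :: "'a adual \<Rightarrow> 'a adual \<Rightarrow> 'a adual" is "(+)"
  by (simp add: blinfun.add_left algebra_simps)
lift_definition minus_adual :: "'a adual \<Rightarrow> 'a adual \<Rightarrow> 'a adual" is "(-)"
  by (simp add: blinfun.diff_left algebra_simps)
lift_definition uminus_adual :: "'a adual \<Rightarrow> 'a adual" is uminus
  by (simp add: blinfun.minus_left)
lift_definition scaleR_adual :: "real \<Rightarrow> 'a adual \<Rightarrow> 'a adual" is scaleR
  by (simp add: blinfun.scaleR_left)
lift_definition scaleC_adual :: "complex \<Rightarrow> 'a adual \<Rightarrow> 'a adual"
  is "\<lambda>a f. blinfun_compose (blinfun_mult_right a) f"
  by simp
lift_definition norm_adual :: "'a adual \<Rightarrow> real" is norm .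

definition dist_adual :: "'a adual \<Rightarrow> 'a adual \<Rightarrow> real" where
  "dist_adual f g = norm (f - g)"
definition sgn_adual :: "'a adual \<Rightarrow> 'a adual" where
  "sgn_adual f = inverse (norm f) *\<^sub>R f"
definition uniformity_adual :: "('a adual \<times> 'a adual) filter" where
  "uniformity_adual = (INF e\<in>{0<..}. principal {(f, g). dist f g < e})"
definition open_adual :: "'a adual set \<Rightarrow> bool" where
  "open_adual S \<longleftrightarrow> (\<forall>f\<in>S. \<forall>\<^sub>F (f', g) in uniformity. f' = f \<longrightarrow> g \<in> S)"

instance
proof
  fix f g h :: "'a adual" and a b :: complex and r s :: real and U :: "'a adual set"
  show "f + g + h = f + (g + h)" by transfer (simp add: add.assoc)
  show "f + g = g + f" by transfer (simp add: add.commute)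
  show "0 + f = f" by transfer simp
  show "- f + f = 0" by transfer simp
  show "f - g = f + - g" by transfer simp
  show "r *\<^sub>R (f + g) = r *\<^sub>R f + r *\<^sub>R g" by transfer (simp add: scaleR_add_right)
  show "(r + s) *\<^sub>R f = r *\<^sub>R f + s *\<^sub>R f" by transfer (simp add: scaleR_add_left)
  show "r *\<^sub>R s *\<^sub>R f = (r * s) *\<^sub>R f" by transfer simp
  show "1 *\<^sub>R f = f" by transfer simp
  show "a *\<^sub>C (f + g) = a *\<^sub>C f + a *\<^sub>C g"
    by transfer (auto intro!: blinfun_eqI simp: blinfun.add_left algebra_simps)
  show "(a + b) *\<^sub>C f = a *\<^sub>C f + b *\<^sub>C f"
    by transfer (auto intro!: blinfun_eqI simp: blinfun.add_left algebra_simps)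
  show "a *\<^sub>C b *\<^sub>C f = (a * b) *\<^sub>C f"
    by transfer (auto intro!: blinfun_eqI)
  show "r *\<^sub>R f = complex_of_real r *\<^sub>C f"
    by transfer (auto intro!: blinfun_eqI simp: blinfun.scaleR_left scaleR_conv_of_real)
  show "dist f g = norm (f - g)" by (fact dist_adual_def)
  show "sgn f = inverse (norm f) *\<^sub>R f" by (fact sgn_adual_def)
  show "(uniformity :: ('a adual \<times> 'a adual) filter) = (INF e\<in>{0<..}. principal {(f, g). dist f g < e})"
    by (fact uniformity_adual_def)
  show "open U \<longleftrightarrow> (\<forall>f\<in>U. \<forall>\<^sub>F (f', g) in uniformity. f' = f \<longrightarrow> g \<in> U)"
    by (fact open_adual_def)
  show "norm f = 0 \<longleftrightarrow> f = 0" by transfer simp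
  show "norm (f + g) \<le> norm f + norm g" by transfer (rule norm_triangle_ineq)
  show "norm (r *\<^sub>R f) = \<bar>r\<bar> * norm f" by transfer simp
  show "norm (a *\<^sub>C f) = cmod a * norm f"
  proof (transfer, rule antisym)
    fix a and f :: "'a \<Rightarrow>\<^sub>L complex"
    have le: "norm (blinfun_mult_right a o\<^sub>L f) \<le> cmod a * norm f" for a and f :: "'a \<Rightarrow>\<^sub>L complex"
      by (rule norm_blinfun_bound)
        (auto simp: norm_mult mult.assoc intro!: mult_left_mono norm_blinfun)
    show "norm (blinfun_mult_right a o\<^sub>L f) \<le> cmod a * norm f" by (fact le)
    show "cmod a * norm f \<le> norm (blinfun_mult_right a o\<^sub>L f)"
    proof (cases "a = 0")
      case False
      have "f = blinfun_mult_right (inverse a) o\<^sub>L (blinfun_mult_right a o\<^sub>L f)"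
        using False by (auto intro!: blinfun_eqI)
      then have "norm f \<le> cmod (inverse a) * norm (blinfun_mult_right a o\<^sub>L f)"
        using le by metis
      then show ?thesis using False by (simp add: norm_divide divide_simps mult.commute)
    qed simp
  qed
qed

end

definition pairing :: "'a::complex_normed_vector adual \<Rightarrow> 'a \<Rightarrow> complex"  (\<open>\<langle>_,/ _\<rangle>\<close>) where
  "\<langle>\<phi>, x\<rangle> = cnj (blinfun_apply (Rep_adual \<phi>) x)"

text \<open>
  \<open>to_adual f\<close> is the element of the dual with \<open>\<langle>to_adual f, x\<rangle> = f x\<close> for a bounded linear
  functional \<open>f\<close>; it is only meaningful for such \<open>f\<close>.
\<close>

definition to_adual :: "('a::complex_normed_vector \<Rightarrow> complex) \<Rightarrow> 'a adual" where
  "to_adual f = Abs_adual (Blinfun (\<lambda>x. cnj (f x)))"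

lemma pairing_to_adual:
  assumes "bounded_linear f" and "\<And>a x. f (a *\<^sub>C x) = a * f x"
  shows "\<langle>to_adual f, x\<rangle> = f x"
proof -
  have bl: "bounded_linear (\<lambda>x. cnj (f x))"
    using assms(1) by (rule bounded_linear_compose[OF bounded_linear_cnj])
  then show ?thesis
    using assms(2) by (simp add: pairing_def to_adual_def Abs_adual_inverse bounded_linear_Blinfun_apply)
qed

lemma pairing_simps:
  "\<langle>\<phi>, x + y\<rangle> = \<langle>\<phi>, x\<rangle> + \<langle>\<phi>, y\<rangle>" "\<langle>\<phi>, a *\<^sub>C x\<rangle> = a * \<langle>\<phi>, x\<rangle>"
  "\<langle>\<phi> + \<psi>, x\<rangle> = \<langle>\<phi>, x\<rangle> + \<langle>\<psi>, x\<rangle>" "\<langle>a *\<^sub>C \<phi>, x\<rangle> = cnj a * \<langle>\<phi>, x\<rangle>"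
  using Rep_adual[of \<phi>]
  by (simp_all add: pairing_def blinfun.add_right blinfun.add_left plus_adual.rep_eq scaleC_adual.rep_eq)

lemma bounded_linear_pairing: "bounded_linear (pairing \<phi>)"
  unfolding pairing_def
  by (rule bounded_linear_compose[OF bounded_linear_cnj blinfun.bounded_linear_right])

lemma bounded_linear_cnj_pairing_left: "bounded_linear (\<lambda>\<phi>. cnj \<langle>\<phi>, x\<rangle>)"
proof (rule bounded_linear_intro)
  show "cnj \<langle>\<phi> + \<psi>, x\<rangle> = cnj \<langle>\<phi>, x\<rangle> + cnj \<langle>\<psi>, x\<rangle>" for \<phi> \<psi>
    by (simp add: pairing_simps)
  show "cnj \<langle>r *\<^sub>R \<phi>, x\<rangle> = r *\<^sub>R cnj \<langle>\<phi>, x\<rangle>" for r \<phi>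
    by (simp add: scaleR_eq_scaleC[of r \<phi>] pairing_simps scaleR_conv_of_real)
  show "norm (cnj \<langle>\<phi>, x\<rangle>) \<le> norm \<phi> * norm x" for \<phi>
    by (simp add: pairing_def norm_adual.rep_eq norm_blinfun)
qed

text \<open>Adjoint \<open>A\<^sup>* : Y\<^sup>* \<rightarrow> X\<^sup>*\<close> of \<open>A : X \<rightarrow> Y\<close> and canonical embedding \<open>X \<rightarrow> X\<^sup>*\<^sup>*\<close>.\<close>

definition dual_op :: "('a::complex_normed_vector \<Rightarrow> 'b::complex_normed_vector) \<Rightarrow> 'b adual \<Rightarrow> 'a adual" where
  "dual_op A \<psi> = to_adual (\<lambda>x. \<langle>\<psi>, A x\<rangle>)"

lemma pairing_dual_op:
  assumes "bounded_clinear A"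
  shows "\<langle>dual_op A \<psi>, x\<rangle> = \<langle>\<psi>, A x\<rangle>"
  unfolding dual_op_def using assms
  by (intro pairing_to_adual bounded_linear_compose[OF bounded_linear_pairing])
    (simp_all add: bounded_clinear_def pairing_simps)

definition bidual_emb :: "'a::complex_normed_vector \<Rightarrow> 'a adual adual" where
  "bidual_emb x = to_adual (\<lambda>\<phi>. cnj \<langle>\<phi>, x\<rangle>)"

lemma pairing_bidual_emb: "\<langle>bidual_emb x, \<phi>\<rangle> = cnj \<langle>\<phi>, x\<rangle>"
  unfolding bidual_emb_def
  by (intro pairing_to_adual bounded_linear_cnj_pairing_left) (simp add: pairing_simps)

definition reflexive_space :: "'a::complex_normed_vector itself \<Rightarrow> bool" where
  "reflexive_space _ \<longleftrightarrow> surj (bidual_emb :: 'a \<Rightarrow> 'a adual adual)"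

text \<open>Riesz identification of a Hilbert space with its dual.\<close>

definition riesz :: "'a::complex_inner \<Rightarrow> 'a adual" where
  "riesz y = to_adual (cinner y)"

lemma norm_cinner_le: "norm (cinner x y) \<le> norm x * norm y"
proof -
  have add_left: "cinner (a + b) c = cinner a c + cinner b c" for a b c :: 'a
    by (metis cinner_commute cinner_add_right complex_cnj_add)
  have scale_left: "cinner (k *\<^sub>C a) b = cnj k * cinner a b" for k and a b :: 'a
    by (metis cinner_commute cinner_scaleC_right complex_cnj_mult)
  have sq: "Re (cinner a a) = (norm a)\<^sup>2" for a :: 'a
    by (simp add: norm_eq_sqrt_cinner cinner_self_nonneg)
  have im: "Im (cinner a a) = 0" for a :: 'a
    using arg_cong[OF cinner_commute[of a a], of Im] by simp
  have self: "cinner a a = complex_of_real ((norm a)\<^sup>2)" for a :: 'a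
    using sq[of a] im[of a] by (simp add: complex_eq_iff)
  show ?thesis
  proof (cases "x = 0")
    case True
    have "cinner 0 y = 0"
      using add_left[of 0 0 y] by simp
    with True show ?thesis by simp
  next
    case False
    define p where "p = cinner x y"
    define k where "k = - p / complex_of_real ((norm x)\<^sup>2)"
    have px: "cinner y x = cnj p" using cinner_commute p_def by metis
    have "cinner (y + k *\<^sub>C x) (y + k *\<^sub>C x)
        = complex_of_real ((norm y)\<^sup>2) + k * cnj p + cnj k * p
          + cnj k * k * complex_of_real ((norm x)\<^sup>2)"
      by (simp only: add_left scale_left cinner_add_right cinner_scaleC_right self[of x] self[of y] px
          p_def[symmetric]) (simp add: algebra_simps)
    also have "\<dots> = complex_of_real ((norm y)\<^sup>2 - (norm p)\<^sup>2 / (norm x)\<^sup>2)"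
      using False complex_norm_square[of p]
      by (simp add: k_def field_simps power2_eq_square)
    finally have "(norm y)\<^sup>2 - (norm p)\<^sup>2 / (norm x)\<^sup>2 \<ge> 0"
      using cinner_self_nonneg[of "y + k *\<^sub>C x"] by simp
    then have "(norm p)\<^sup>2 \<le> (norm x * norm y)\<^sup>2"
      using False by (simp add: field_simps power_mult_distrib)
    then show ?thesis
      unfolding p_def by (rule power2_le_imp_le) simp
  qed
qed

lemma pairing_riesz: "\<langle>riesz y, z\<rangle> = cinner y z"
proof -
  have "bounded_linear (cinner y)"
  proof (rule bounded_linear_intro[where K = "norm y"])
    show "cinner y (r *\<^sub>R x) = r *\<^sub>R cinner y x" for r x
      by (simp add: scaleR_eq_scaleC[of r x] cinner_scaleC_right scaleR_conv_of_real)
    show "norm (cinner y x) \<le> norm x * norm y" for x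
      using norm_cinner_le[of y x] by (simp add: mult.commute)
  qed (fact cinner_add_right)
  then show ?thesis
    unfolding riesz_def by (rule pairing_to_adual) (simp add: cinner_scaleC_right)
qed

text \<open>Adjoint \<open>G\<^sup>* : Y \<rightarrow> X\<^sup>*\<close> of \<open>G : X \<rightarrow> Y\<close>, with \<open>Y\<close> identified with its dual.\<close>

definition adj :: "('x::complex_normed_vector \<Rightarrow> 'y::complex_inner) \<Rightarrow> 'y \<Rightarrow> 'x adual" where
  "adj G y = dual_op G (riesz y)"

lemma pairing_adj: "bounded_clinear G \<Longrightarrow> \<langle>adj G y, x\<rangle> = cinner y (G x)"
  by (simp add: adj_def pairing_dual_op pairing_riesz)

text \<open>
  Dense continuous embedding \<open>X \<subset> U\<close>, given by the map \<open>\<iota>\<close>. The second embedding \<open>U \<subset> X\<^sup>*\<close> of the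
  triple is then \<open>adj \<iota>\<close>, i.e. \<open>\<langle>adj \<iota> u, x\<rangle> = cinner u (\<iota> x)\<close> (lemma \<open>pairing_adj\<close>), which is how the
  pairing extends the inner product of \<open>U\<close>.
\<close>

definition gelfand_triple :: "('x::complex_normed_vector \<Rightarrow> 'u::complex_inner) \<Rightarrow> bool" where
  "gelfand_triple \<iota> \<longleftrightarrow> bounded_clinear \<iota> \<and> inj \<iota> \<and> closure (range \<iota>) = UNIV"


section \<open>Operators from the dual of a reflexive space to the space\<close>

text \<open>Adjoint of \<open>T : X\<^sup>* \<rightarrow> X\<close>, as an operator \<open>X\<^sup>* \<rightarrow> X\<^sup>*\<^sup>* = X\<close>.\<close>

definition dadj :: "('x::complex_normed_vector adual \<Rightarrow> 'x) \<Rightarrow> 'x adual \<Rightarrow> 'x" where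
  "dadj T \<phi> = inv bidual_emb (dual_op T \<phi>)"

lemma pairing_dadj:
  fixes T :: "'x::complex_normed_vector adual \<Rightarrow> 'x"
  assumes "reflexive_space TYPE('x)" "bounded_clinear T"
  shows "\<langle>\<psi>, dadj T \<phi>\<rangle> = cnj \<langle>\<phi>, T \<psi>\<rangle>"
proof -
  have "bidual_emb (dadj T \<phi>) = dual_op T \<phi>"
    using assms(1) unfolding dadj_def reflexive_space_def by (rule surj_f_inv_f)
  then have "cnj \<langle>\<psi>, dadj T \<phi>\<rangle> = \<langle>\<phi>, T \<psi>\<rangle>"
    using assms(2) by (metis pairing_bidual_emb pairing_dual_op)
  then show ?thesis by (metis complex_cnj_cnj)
qed

definition dRe :: "('x::complex_normed_vector adual \<Rightarrow> 'x) \<Rightarrow> 'x adual \<Rightarrow> 'x" where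
  "dRe T \<phi> = (1/2) *\<^sub>C (T \<phi> + dadj T \<phi>)"

definition dselfadjoint :: "('x::complex_normed_vector adual \<Rightarrow> 'x) \<Rightarrow> bool" where
  "dselfadjoint C \<longleftrightarrow> bounded_clinear C \<and> dadj C = C"

text \<open>For self-adjoint \<open>C\<close> the values \<open>\<langle>\<phi>, C \<phi>\<rangle>\<close> are real, so nothing is lost by taking \<open>Re\<close>.\<close>

definition coercive :: "('x::complex_normed_vector adual \<Rightarrow> 'x) \<Rightarrow> bool" where
  "coercive C \<longleftrightarrow> (\<exists>c>0. \<forall>\<phi>. Re \<langle>\<phi>, C \<phi>\<rangle> \<ge> c * (norm \<phi>)\<^sup>2)"


section \<open>Operators on a Hilbert space\<close>

definition hadj :: "('y::complex_inner \<Rightarrow> 'y) \<Rightarrow> 'y \<Rightarrow> 'y" where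
  "hadj A y = inv riesz (dual_op A (riesz y))"

definition hRe :: "('y::complex_inner \<Rightarrow> 'y) \<Rightarrow> 'y \<Rightarrow> 'y" where
  "hRe A y = (1/2) *\<^sub>C (A y + hadj A y)"

definition hIm :: "('y::complex_inner \<Rightarrow> 'y) \<Rightarrow> 'y \<Rightarrow> 'y" where
  "hIm A y = (1/(2*\<i>)) *\<^sub>C (A y - hadj A y)"

definition hselfadjoint :: "('y::complex_inner \<Rightarrow> 'y) \<Rightarrow> bool" where
  "hselfadjoint A \<longleftrightarrow> bounded_clinear A \<and> hadj A = A"

definition nonneg_op :: "('y::complex_inner \<Rightarrow> 'y) \<Rightarrow> bool" where
  "nonneg_op A \<longleftrightarrow> hselfadjoint A \<and> (\<forall>y. 0 \<le> Re (cinner y (A y)))"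

text \<open>The unique non-negative square root of a non-negative bounded operator.\<close>

definition sqrt_op :: "('y::complex_inner \<Rightarrow> 'y) \<Rightarrow> 'y \<Rightarrow> 'y" where
  "sqrt_op A = (THE S. nonneg_op S \<and> S \<circ> S = A)"

definition abs_op :: "('y::complex_inner \<Rightarrow> 'y) \<Rightarrow> 'y \<Rightarrow> 'y" where
  "abs_op A = sqrt_op (A \<circ> A)"

definition F_sharp :: "real \<Rightarrow> ('y::complex_inner \<Rightarrow> 'y) \<Rightarrow> 'y \<Rightarrow> 'y" where
  "F_sharp t F y = abs_op (hRe (\<lambda>z. exp (\<i> * complex_of_real t) *\<^sub>C F z)) y + hIm F y"

end

theory Submission
  imports Defs
begin

text \<open>
  Write \<open>A = Re (e\<^sup>i\<^sup>t F) = G (C + K) G\<^sup>*\<close>. Everything follows from two-sided bounds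
  \<open>d \<parallel>G\<^sup>* y\<parallel>\<^sup>2 \<le> \<langle>y, F\<^sub># y\<rangle> \<le> k \<parallel>G\<^sup>* y\<parallel>\<^sup>2\<close>: since the middle term is \<open>\<parallel>F\<^sub>#\<^sup>1\<^sup>/\<^sup>2 y\<parallel>\<^sup>2\<close>,
  each of the two ranges is characterised by boundedness of the same functionals, the coercive
  form of \<open>C\<close> serving as inner product on \<open>X\<^sup>*\<close>.
  For the lower bound, use \<open>A \<le> \<bar>A\<bar>\<close>. If it failed, a normalised sequence \<open>G\<^sup>* y\<^sub>n\<close> with
  \<open>\<langle>y\<^sub>n, F\<^sub># y\<^sub>n\<rangle> \<rightarrow> 0\<close> would, after passing to a subsequence along which \<open>K G\<^sup>* y\<^sub>n\<close> converges,
  converge in norm by coercivity of \<open>C\<close> to a unit vector in the closure of the range of \<open>G\<^sup>*\<close> on which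
  \<open>Im T\<close> vanishes.
  For the upper bound, compactness of \<open>K\<close> makes the negative part \<open>B\<close> of \<open>A\<close> of finite rank, so that
  \<open>\<langle>y, B y\<rangle>\<close> is bounded by a multiple of \<open>\<parallel>B y\<parallel>\<^sup>2 \<le> \<parallel>A y\<parallel>\<^sup>2\<close>, hence of \<open>\<parallel>G\<^sup>* y\<parallel>\<^sup>2\<close>.
\<close>

section \<open>Real inner product structure\<close>

text \<open>The operator theory below runs over the reals with this inner product, so that real
  linear notions apply; complex linearity is recovered separately from commutation with
  \<open>\<i>\<close>.\<close>

definition re_inner :: "'a::complex_inner \<Rightarrow> 'a \<Rightarrow> real" where
  "re_inner x y = Re (cinner x y)"

lemma re_inner_commute: "re_inner x y = re_inner y x"
  unfolding re_inner_def using cinner_commute[of x y] by simp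

lemma abs_re_inner_le: "\<bar>re_inner x y\<bar> \<le> norm x * norm y"
  unfolding re_inner_def using abs_Re_le_cmod norm_cinner_le order_trans by blast

lemma re_inner_self: "re_inner x x = (norm x)\<^sup>2"
  by (simp add: re_inner_def norm_eq_sqrt_cinner cinner_self_nonneg)

lemma bounded_bilinear_re_inner: "bounded_bilinear re_inner"
proof
  fix x y z :: 'a and r :: real
  show add: "re_inner x (y + z) = re_inner x y + re_inner x z" for x y z :: 'a
    by (simp add: re_inner_def cinner_add_right)
  show scale: "re_inner x (r *\<^sub>R y) = r *\<^sub>R re_inner x y" for x y :: 'a
    by (simp add: re_inner_def scaleR_eq_scaleC[of r y] cinner_scaleC_right)
  show "re_inner (x + y) z = re_inner x z + re_inner y z"
    using add[of z x y] by (simp add: re_inner_commute)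
  show "re_inner (r *\<^sub>R x) y = r *\<^sub>R re_inner x y"
    using scale[of y x] by (simp add: re_inner_commute)
  show "\<exists>K. \<forall>a b :: 'a. norm (re_inner a b) \<le> norm a * norm b * K"
    by (intro exI[of _ 1]) (simp add: abs_re_inner_le)
qed

interpretation re_inner: bounded_bilinear re_inner
  by (rule bounded_bilinear_re_inner)

lemma re_inner_eqI:
  assumes "\<And>z. re_inner z x = re_inner z y"
  shows "x = y"
proof -
  have "(norm (x - y))\<^sup>2 = 0"
    using assms[of "x - y"] by (simp flip: re_inner_self add: re_inner.diff_right)
  then show ?thesis by simp
qed

lemma scaleC_one [simp]: "(1::complex) *\<^sub>C x = x"
  using scaleR_eq_scaleC[of 1 x] by simp

lemma bounded_linear_scaleC: "bounded_linear (\<lambda>x::'a::complex_normed_vector. a *\<^sub>C x)"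
proof (rule bounded_linear_intro[where K = "cmod a"])
  show "a *\<^sub>C r *\<^sub>R x = r *\<^sub>R a *\<^sub>C x" for r and x :: 'a
    by (simp add: scaleR_eq_scaleC[of r x] scaleR_eq_scaleC[of r "a *\<^sub>C x"] scaleC_scaleC mult.commute)
qed (simp_all add: scaleC_add_right norm_scaleC)

text \<open>A complex scalar \<open>a\<close> acts as \<open>Re a + Im a * \<i>\<close>, so real
  linearity and a single commutation relation cover all scalars.\<close>

lemma bounded_clinearI:
  assumes "bounded_linear A" "\<And>x. A (\<i> *\<^sub>C x) = \<i> *\<^sub>C A x"
  shows "bounded_clinear A"
  unfolding bounded_clinear_def
proof (intro conjI allI)
  interpret A: bounded_linear A by fact
  fix a x
  have dec: "a *\<^sub>C z = Re a *\<^sub>R z + Im a *\<^sub>R (\<i> *\<^sub>C z)" for z :: "'c::complex_normed_vector"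
    unfolding scaleR_eq_scaleC[of _ z] scaleR_eq_scaleC[of _ "\<i> *\<^sub>C z"] scaleC_scaleC
    by (metis scaleC_add_left complex_eq mult.commute)
  show "A (a *\<^sub>C x) = a *\<^sub>C A x"
    unfolding dec by (simp add: A.add A.scaleR assms(2))
qed (fact assms(1))

section \<open>Square roots of positive operators\<close>

text \<open>Operators are only required to be real linear: commutation with multiplication by
  \<open>\<i>\<close> makes the square root of a complex linear operator complex linear.\<close>

definition symmetric_op :: "('a::complex_inner \<Rightarrow> 'a) \<Rightarrow> bool" where
  "symmetric_op A \<longleftrightarrow> bounded_linear A \<and> (\<forall>x y. re_inner (A x) y = re_inner x (A y))"

definition positive_op :: "('a::complex_inner \<Rightarrow> 'a) \<Rightarrow> bool" where
  "positive_op A \<longleftrightarrow> symmetric_op A \<and> (\<forall>x. 0 \<le> re_inner x (A x))"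

lemma symmetric_opD:
  assumes "symmetric_op A"
  shows "bounded_linear A" "re_inner (A x) y = re_inner x (A y)"
  using assms by (auto simp: symmetric_op_def)

lemma symmetric_op_diff:
  assumes "symmetric_op A" "symmetric_op B"
  shows "symmetric_op (\<lambda>x. A x - B x)"
  using assms by (auto simp: symmetric_op_def bounded_linear_sub re_inner.diff_left re_inner.diff_right)

lemma symmetric_op_square_eq_0:
  assumes "symmetric_op A" "A (A x) = 0"
  shows "A x = 0"
proof -
  have "(norm (A x))\<^sup>2 = re_inner x (A (A x))"
    using assms(1) by (simp flip: re_inner_self add: symmetric_opD)
  then show ?thesis using assms(2) by (simp add: re_inner.zero_right)
qed

lemma symmetric_op_norm_square:
  "symmetric_op A \<Longrightarrow> re_inner x (A (A x)) = (norm (A x))\<^sup>2"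
  by (simp flip: re_inner_self add: symmetric_opD)

lemma positive_op_square: "symmetric_op A \<Longrightarrow> positive_op (\<lambda>x. A (A x))"
  unfolding positive_op_def
  by (auto simp: symmetric_op_norm_square) (auto simp: symmetric_op_def bounded_linear_compose)

lemma positive_op_scaleR:
  assumes "positive_op A" "0 \<le> r"
  shows "positive_op (\<lambda>x. r *\<^sub>R A x)"
  using assms by (auto simp: positive_op_def symmetric_op_def bounded_linear_const_scaleR
      re_inner.scaleR_left re_inner.scaleR_right)

text \<open>The quadratic form at \<open>x + s *\<^sub>R y\<close> is a nonnegative polynomial in
  the real variable \<open>s\<close>, which bounds its discriminant.\<close>

lemma positive_op_Cauchy_Schwarz:
  assumes "positive_op A"
  shows "(re_inner x (A y))\<^sup>2 \<le> re_inner x (A x) * re_inner y (A y)"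
proof -
  have sym: "re_inner y (A x) = re_inner x (A y)"
    using assms by (metis positive_op_def symmetric_opD(2) re_inner_commute)
  interpret A: bounded_linear A
    using assms by (simp add: positive_op_def symmetric_op_def)
  define a b c where "a = re_inner x (A x)" and "b = re_inner x (A y)" and "c = re_inner y (A y)"
  have pos: "0 \<le> a + 2 * s * b + s\<^sup>2 * c" for s
  proof -
    have "0 \<le> re_inner (x + s *\<^sub>R y) (A (x + s *\<^sub>R y))"
      using assms by (simp add: positive_op_def)
    also have "\<dots> = a + 2 * s * b + s\<^sup>2 * c"
      by (simp add: A.add A.scaleR re_inner.add_left re_inner.add_right re_inner.scaleR_left
          re_inner.scaleR_right sym a_def b_def c_def power2_eq_square algebra_simps)
    finally show ?thesis .
  qed
  have ac: "0 \<le> a" "0 \<le> c" using assms by (auto simp: positive_op_def a_def c_def)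
  have "b\<^sup>2 \<le> a * c"
  proof (cases "c = 0")
    case True
    have "b = 0"
    proof (rule ccontr)
      assume "b \<noteq> 0"
      \<comment> \<open>This \<open>s\<close> makes the remaining affine expression
        \<open>a + 2 * s * b\<close> equal to -1.\<close>
      then show False using pos[of "- (a + 1) / (2 * b)"] True ac by (simp add: field_simps)
    qed
    then show ?thesis using ac by simp
  next
    case False
    then have "0 \<le> (a + 2 * (- b / c) * b + (- b / c)\<^sup>2 * c) * c"
      using pos[of "- b / c"] ac by (intro mult_nonneg_nonneg) auto
    also have "\<dots> = a * c - b\<^sup>2"
      using False by (simp add: field_simps power2_eq_square)
    finally show ?thesis by simp
  qed
  then show ?thesis by (simp add: a_def b_def c_def)
qed

text \<open>Cauchy-Schwarz at the pair \<open>A x\<close>, \<open>x\<close> bounds the fourth power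
  of \<open>norm (A x)\<close> by zero.\<close>

lemma positive_op_eq_0:
  assumes "positive_op A" "re_inner x (A x) = 0"
  shows "A x = 0"
  using positive_op_Cauchy_Schwarz[OF assms(1), of "A x" x] assms(2)
  by (simp add: re_inner_self)

text \<open>Cauchy-Schwarz at \<open>A x\<close> and \<open>x\<close> yields
  \<open>(norm (A x))\<^sup>2 \<le> re_inner x (A x)\<close>, so the cross term in the expanded
  square outweighs the last one. This lets \<open>I - A\<close> start the square root
  iteration.\<close>

lemma positive_contraction_complement:
  assumes "positive_op A" "\<And>x. norm (A x) \<le> norm x"
  shows "norm (x - A x) \<le> norm x"
proof -
  have "((norm (A x))\<^sup>2)\<^sup>2 \<le> re_inner x (A x) * (norm (A x))\<^sup>2"
  proof -
    have "((norm (A x))\<^sup>2)\<^sup>2 \<le> re_inner (A x) (A (A x)) * re_inner x (A x)"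
      using positive_op_Cauchy_Schwarz[OF assms(1), of "A x" x] by (simp add: re_inner_self)
    also have "\<dots> \<le> (norm (A x))\<^sup>2 * re_inner x (A x)"
    proof (rule mult_right_mono)
      have "re_inner (A x) (A (A x)) \<le> norm (A x) * norm (A (A x))"
        using abs_re_inner_le abs_le_D1 by blast
      also have "\<dots> \<le> norm (A x) * norm (A x)"
        by (intro mult_left_mono assms(2)) simp
      finally show "re_inner (A x) (A (A x)) \<le> (norm (A x))\<^sup>2"
        by (simp add: power2_eq_square)
      show "0 \<le> re_inner x (A x)" using assms(1) by (simp add: positive_op_def)
    qed
    finally show ?thesis by (simp add: mult.commute)
  qed
  then have le: "(norm (A x))\<^sup>2 \<le> re_inner x (A x)"
    using assms(1) by (cases "A x = 0") (auto simp: positive_op_def power2_eq_square re_inner.zero_right)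
  have "(norm (x - A x))\<^sup>2 = (norm x)\<^sup>2 - 2 * re_inner x (A x) + (norm (A x))\<^sup>2"
    by (simp flip: re_inner_self add: re_inner.diff_left re_inner.diff_right re_inner_commute[of "A x" x])
  also have "\<dots> \<le> (norm x)\<^sup>2"
    using le zero_le_power2[of "norm (A x)"] by linarith
  finally show ?thesis by (simp add: power2_le_iff_abs_le)
qed

text \<open>\<open>dominated B Y r\<close> says that \<open>Y = p(B)\<close> and \<open>r = p(1)\<close> for a polynomial \<open>p\<close> with
  nonnegative coefficients. If \<open>B\<close> is a contraction this bounds the norm of \<open>Y\<close> by \<open>r\<close>, which
  reduces convergence of operator iterations to convergence of scalar ones.\<close>

inductive dominated :: "('a::real_normed_vector \<Rightarrow> 'a) \<Rightarrow> ('a \<Rightarrow> 'a) \<Rightarrow> real \<Rightarrow> bool" for B where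
  zero: "dominated B (\<lambda>_. 0) 0"
| base: "dominated B B 1"
| add: "dominated B Y r \<Longrightarrow> dominated B Z s \<Longrightarrow> dominated B (\<lambda>x. Y x + Z x) (r + s)"
| comp: "dominated B Y r \<Longrightarrow> dominated B Z s \<Longrightarrow> dominated B (\<lambda>x. Y (Z x)) (r * s)"
| scaleR: "dominated B Y r \<Longrightarrow> 0 \<le> a \<Longrightarrow> dominated B (\<lambda>x. a *\<^sub>R Y x) (a * r)"

section \<open>Norms, commutation and symmetry of operator polynomials\<close>

lemma dominated_bounded_linear:
  "dominated B Y r \<Longrightarrow> bounded_linear B \<Longrightarrow> bounded_linear Y"
  by (induction rule: dominated.induct)
    (auto intro: bounded_linear_zero bounded_linear_add bounded_linear_compose
      bounded_linear_const_scaleR)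

lemma dominated_nonneg: "dominated B Y r \<Longrightarrow> 0 \<le> r"
  by (induction rule: dominated.induct) auto

lemma dominated_norm_le:
  assumes "dominated B Y r" "\<And>x. norm (B x) \<le> norm x"
  shows "norm (Y x) \<le> r * norm x"
  using assms(1)
proof (induction arbitrary: x rule: dominated.induct)
  case (add Y r Z s)
  show ?case
    using norm_triangle_ineq[of "Y x" "Z x"] add.IH(1)[of x] add.IH(2)[of x]
    by (simp add: distrib_right)
next
  case (comp Y r Z s)
  have "norm (Y (Z x)) \<le> r * norm (Z x)" by fact
  also have "\<dots> \<le> r * (s * norm x)"
    by (intro mult_left_mono comp.IH dominated_nonneg[OF comp.hyps(1)])
  finally show ?case by (simp add: mult.assoc)
next
  case (scaleR Y r a)
  then show ?case by (auto simp: mult.assoc intro!: mult_left_mono)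
qed (use assms(2) in auto)

text \<open>Commutation passes through the iteration to its limit; this is why the square root
  commutes with every bounded operator that commutes with the given one.\<close>

lemma dominated_commute_with:
  assumes "dominated B Y r" "bounded_linear W" "\<And>x. W (B x) = B (W x)"
  shows "W (Y x) = Y (W x)"
proof -
  interpret W: bounded_linear W by fact
  show ?thesis using assms(1)
    by (induction arbitrary: x rule: dominated.induct)
      (auto simp: W.add W.scaleR W.zero assms(3))
qed

lemma dominated_commute:
  assumes "dominated B Y r" "dominated B Z s" "bounded_linear B"
  shows "Y (Z x) = Z (Y x)"
  using assms dominated_commute_with[of B Z s Y x] dominated_commute_with[of B Y r B]
    dominated_bounded_linear by metis

text \<open>Only products need an argument: two symmetric operators that commute have a symmetric
  product.\<close>

lemma dominated_symmetric:
  assumes "dominated B Y r" "symmetric_op B"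
  shows "symmetric_op Y"
  using assms(1)
proof (induction rule: dominated.induct)
  case (comp Y r Z s)
  have c: "Y (Z x) = Z (Y x)" for x
    using comp.hyps assms(2) by (intro dominated_commute) (auto simp: symmetric_op_def)
  show ?case
    using comp.IH c by (auto simp: symmetric_op_def bounded_linear_compose)
qed (use assms(2) in \<open>auto simp: symmetric_op_def bounded_linear_add bounded_linear_const_scaleR
      re_inner.add_left re_inner.add_right re_inner.scaleR_left re_inner.scaleR_right
      re_inner.zero_left re_inner.zero_right\<close>)

text \<open>With \<open>B = I - A\<close>, the fixed point \<open>Y = (B + Y\<^sup>2) / 2\<close> satisfies \<open>(I - Y)\<^sup>2 = A\<close>.\<close>

primrec sqrt_iter :: "('a::real_normed_vector \<Rightarrow> 'a) \<Rightarrow> nat \<Rightarrow> 'a \<Rightarrow> 'a" where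
  "sqrt_iter B 0 = (\<lambda>_. 0)"
| "sqrt_iter B (Suc n) = (\<lambda>x. (1/2) *\<^sub>R (B x + sqrt_iter B n (sqrt_iter B n x)))"

text \<open>The recursion of \<open>sqrt_iter\<close> for the scalar \<open>B = 1\<close>, whose
  only fixed point is 1.\<close>

primrec sqrt_iter_bound :: "nat \<Rightarrow> real" where
  "sqrt_iter_bound 0 = 0"
| "sqrt_iter_bound (Suc n) = (1/2) * (1 + sqrt_iter_bound n * sqrt_iter_bound n)"

section \<open>Convergence of the square root iteration\<close>

lemma dominated_sqrt_iter: "dominated B (sqrt_iter B n) (sqrt_iter_bound n)"
  by (induction n) (simp_all only: sqrt_iter.simps sqrt_iter_bound.simps, (rule dominated.intros | simp)+)

text \<open>For consecutive iterates \<open>Y\<close> and \<open>Z\<close>, which commute, the next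
  increment is half of \<open>Z\<^sup>2 - Y\<^sup>2 = Z (Z - Y) + Y (Z - Y)\<close>. Nonnegative
  coefficients of \<open>Z - Y\<close> therefore persist.\<close>

lemma dominated_sqrt_iter_Suc_diff:
  assumes "bounded_linear B"
  shows "dominated B (\<lambda>x. sqrt_iter B (Suc n) x - sqrt_iter B n x)
    (sqrt_iter_bound (Suc n) - sqrt_iter_bound n)"
proof (induction n)
  case 0
  show ?case using dominated.scaleR[OF dominated.base, of "1/2" B] by simp
next
  case (Suc n)
  let ?Y = "sqrt_iter B n" and ?Z = "sqrt_iter B (Suc n)"
  let ?r = "sqrt_iter_bound n" and ?s = "sqrt_iter_bound (Suc n)"
  interpret Y: bounded_linear ?Y
    using dominated_bounded_linear[OF dominated_sqrt_iter assms] .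
  interpret Z: bounded_linear ?Z
    using dominated_bounded_linear[OF dominated_sqrt_iter assms] .
  have c: "?Y (?Z x) = ?Z (?Y x)" for x
    by (rule dominated_commute[OF dominated_sqrt_iter dominated_sqrt_iter assms])
  have "dominated B (\<lambda>x. (1/2) *\<^sub>R (?Z (?Z x - ?Y x) + ?Y (?Z x - ?Y x)))
      ((1/2) * (?s * (?s - ?r) + ?r * (?s - ?r)))"
    by (intro dominated.scaleR dominated.add dominated.comp[OF _ Suc.IH] dominated_sqrt_iter) simp
  also have "(\<lambda>x. (1/2) *\<^sub>R (?Z (?Z x - ?Y x) + ?Y (?Z x - ?Y x)))
      = (\<lambda>x. sqrt_iter B (Suc (Suc n)) x - ?Z x)"
  proof
    fix x
    have "sqrt_iter B (Suc (Suc n)) x - ?Z x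
        = (1/2) *\<^sub>R (B x + ?Z (?Z x)) - (1/2) *\<^sub>R (B x + ?Y (?Y x))"
      by (simp only: sqrt_iter.simps(2))
    also have "\<dots> = (1/2) *\<^sub>R (?Z (?Z x) - ?Y (?Y x))"
      by (simp only: scaleR_right_diff_distrib[symmetric] add_diff_cancel_left)
    also have "?Z (?Z x) - ?Y (?Y x) = ?Z (?Z x - ?Y x) + ?Y (?Z x - ?Y x)"
      by (simp only: Z.diff Y.diff c) (simp only: diff_add_eq add_diff_cancel_right' diff_add_cancel add_diff_eq)
    finally show "(1/2) *\<^sub>R (?Z (?Z x - ?Y x) + ?Y (?Z x - ?Y x)) = sqrt_iter B (Suc (Suc n)) x - ?Z x" ..
  qed
  also have "(1/2) * (?s * (?s - ?r) + ?r * (?s - ?r)) = sqrt_iter_bound (Suc (Suc n)) - ?s"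
    by (simp only: sqrt_iter_bound.simps(2)[of "Suc n"] sqrt_iter_bound.simps(2)[of n])
      (simp add: algebra_simps)
  finally show ?case .
qed

lemma sqrt_iter_bound_le_1: "sqrt_iter_bound n \<le> 1"
proof (induction n)
  case (Suc n)
  have "sqrt_iter_bound n * sqrt_iter_bound n \<le> 1 * 1"
    using Suc dominated_nonneg[OF dominated_sqrt_iter, of n] by (intro mult_mono) auto
  then show ?case by simp
qed simp

lemma dominated_sqrt_iter_diff:
  assumes "bounded_linear B" "n \<le> m"
  shows "dominated B (\<lambda>x. sqrt_iter B m x - sqrt_iter B n x) (sqrt_iter_bound m - sqrt_iter_bound n)"
  using assms(2)
proof (induction m rule: dec_induct)
  case base
  show ?case using dominated.zero by simp
next
  case (step m)
  show ?case
    using dominated.add[OF step.IH dominated_sqrt_iter_Suc_diff[OF assms(1), of m]]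
    by (simp del: sqrt_iter.simps sqrt_iter_bound.simps)
qed

text \<open>Bounded and monotone, the latter because a dominating number is never negative. The
  numbers do not mention \<open>B\<close>, so the identity on the reals may stand for it.\<close>

lemma convergent_sqrt_iter_bound: "convergent sqrt_iter_bound"
proof (rule Bseq_mono_convergent)
  show "Bseq sqrt_iter_bound"
  proof (rule BseqI')
    show "norm (sqrt_iter_bound n) \<le> 1" for n
      using sqrt_iter_bound_le_1[of n] dominated_nonneg[OF dominated_sqrt_iter[of "\<lambda>x::real. x" n]] by simp
  qed
  show "\<forall>m. \<forall>n\<ge>m. sqrt_iter_bound m \<le> sqrt_iter_bound n"
    using dominated_nonneg[OF dominated_sqrt_iter_diff[of "\<lambda>x::real. x"]]
    by (simp add: bounded_linear_ident)
qed

lemma Cauchy_sqrt_iter: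
  assumes "bounded_linear B" "\<And>x. norm (B x) \<le> norm x"
  shows "Cauchy (\<lambda>n. sqrt_iter B n x)"
proof (rule metric_CauchyI)
  fix e :: real assume "0 < e"
  have "Cauchy sqrt_iter_bound"
    by (rule convergent_Cauchy[OF convergent_sqrt_iter_bound])
  \<comment> \<open>Adding 1 keeps the divisor positive at \<open>x = 0\<close>.\<close>
  moreover have "0 < e / (norm x + 1)" using \<open>0 < e\<close> by (simp add: add_nonneg_pos)
  ultimately obtain N where N: "dist (sqrt_iter_bound m) (sqrt_iter_bound n) < e / (norm x + 1)"
    if "m \<ge> N" "n \<ge> N" for m n
    by (meson metric_CauchyD)
  have le: "dist (sqrt_iter B m x) (sqrt_iter B n x) < e" if "N \<le> n" "n \<le> m" for m n
  proof -
    have "dist (sqrt_iter B m x) (sqrt_iter B n x) \<le> (sqrt_iter_bound m - sqrt_iter_bound n) * norm x"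
      unfolding dist_norm
      by (rule dominated_norm_le[OF dominated_sqrt_iter_diff]) (use assms that in auto)
    also have "\<dots> \<le> (sqrt_iter_bound m - sqrt_iter_bound n) * (norm x + 1)"
      using dominated_nonneg[OF dominated_sqrt_iter_diff[OF assms(1) that(2)]]
      by (intro mult_left_mono) auto
    also have "\<dots> < e / (norm x + 1) * (norm x + 1)"
      using N[of m n] that by (intro mult_strict_right_mono) (auto simp: dist_real_def add_nonneg_pos)
    also have "\<dots> = e" using add_nonneg_pos[OF norm_ge_zero[of x] zero_less_one] by simp
    finally show ?thesis .
  qed
  show "\<exists>M. \<forall>m\<ge>M. \<forall>n\<ge>M. dist (sqrt_iter B m x) (sqrt_iter B n x) < e"
    by (rule exI[of _ N]) (metis le dist_commute nle_le)
qed

text \<open>The pointwise limit \<open>Y\<close> of the iteration for \<open>B = I - A\<close>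
  solves the fixed point equation, and \<open>S = I - Y\<close>. The commutation clause is carried
  along because uniqueness and complex linearity of the root rest on it.\<close>

lemma positive_contraction_sqrt_exists:
  fixes A :: "'a::complex_hilbert \<Rightarrow> 'a"
  assumes A: "positive_op A" "\<And>x. norm (A x) \<le> norm x"
  shows "\<exists>S. positive_op S \<and> (\<forall>x. S (S x) = A x) \<and>
    (\<forall>Z. bounded_linear Z \<longrightarrow> (\<forall>x. Z (A x) = A (Z x)) \<longrightarrow> (\<forall>x. Z (S x) = S (Z x)))"
proof -
  define B where "B = (\<lambda>x. x - A x)"
  have symA: "symmetric_op A" using A(1) by (simp add: positive_op_def)
  have symB: "symmetric_op B"
    using symmetric_op_diff[OF _ symA, of "\<lambda>x. x"]
    by (simp add: B_def symmetric_op_def bounded_linear_ident)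
  have linB: "bounded_linear B" using symB by (simp add: symmetric_op_def)
  have contr: "norm (B x) \<le> norm x" for x
    unfolding B_def by (rule positive_contraction_complement[OF A])
  define Y where "Y = (\<lambda>x. lim (\<lambda>n. sqrt_iter B n x))"
  have lim: "(\<lambda>n. sqrt_iter B n x) \<longlonglongrightarrow> Y x" for x
    unfolding Y_def
    using Cauchy_sqrt_iter[OF linB contr] Cauchy_convergent convergent_LIMSEQ_iff by blast
  have iter_le: "norm (sqrt_iter B n x) \<le> norm x" for n x
    using dominated_norm_le[OF dominated_sqrt_iter[of B n] contr, of x]
      mult_right_mono[OF sqrt_iter_bound_le_1[of n] norm_ge_zero[of x]] by simp
  have iter_sym: "symmetric_op (sqrt_iter B n)" for n
    by (rule dominated_symmetric[OF dominated_sqrt_iter symB])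
  have iter_lin: "bounded_linear (sqrt_iter B n)" for n
    using iter_sym by (simp add: symmetric_op_def)
  have Y_le: "norm (Y x) \<le> norm x" for x
    by (rule LIMSEQ_le_const2[OF tendsto_norm[OF lim]]) (simp add: iter_le)
  have linY: "bounded_linear Y"
  proof (rule bounded_linear_intro[where K = 1])
    show "Y (x + y) = Y x + Y y" for x y
    proof (rule LIMSEQ_unique[OF lim])
      show "(\<lambda>n. sqrt_iter B n (x + y)) \<longlonglongrightarrow> Y x + Y y"
        using tendsto_add[OF lim lim] by (simp add: linear_add[OF bounded_linear.linear[OF iter_lin]])
    qed
    show "Y (r *\<^sub>R x) = r *\<^sub>R Y x" for r x
    proof (rule LIMSEQ_unique[OF lim])
      show "(\<lambda>n. sqrt_iter B n (r *\<^sub>R x)) \<longlonglongrightarrow> r *\<^sub>R Y x"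
        using tendsto_scaleR[OF tendsto_const lim]
        by (simp add: linear_scale[OF bounded_linear.linear[OF iter_lin]])
    qed
  qed (simp add: Y_le)
  interpret Y: bounded_linear Y by (rule linY)
  have symY: "symmetric_op Y"
    unfolding symmetric_op_def
  proof (intro conjI allI linY)
    fix x y
    have "(\<lambda>n. re_inner (sqrt_iter B n x) y) \<longlonglongrightarrow> re_inner (Y x) y"
      by (intro re_inner.tendsto lim tendsto_const)
    moreover have "(\<lambda>n. re_inner (sqrt_iter B n x) y) \<longlonglongrightarrow> re_inner x (Y y)"
      unfolding symmetric_opD(2)[OF iter_sym] by (intro re_inner.tendsto lim tendsto_const)
    ultimately show "re_inner (Y x) y = re_inner x (Y y)" by (rule LIMSEQ_unique)
  qed
  have fixpoint: "Y x = (1/2) *\<^sub>R (B x + Y (Y x))" for x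
  proof -
    \<comment> \<open>Pointwise convergence is enough for the squares because every iterate is a
      contraction and does not enlarge the error of the inner argument.\<close>
    have "(\<lambda>n. sqrt_iter B n (sqrt_iter B n x) - sqrt_iter B n (Y x)) \<longlonglongrightarrow> 0"
    proof (rule Lim_null_comparison)
      show "\<forall>\<^sub>F n in sequentially. norm (sqrt_iter B n (sqrt_iter B n x) - sqrt_iter B n (Y x))
          \<le> norm (sqrt_iter B n x - Y x)"
        by (simp flip: linear_diff[OF bounded_linear.linear[OF iter_lin]] add: iter_le)
      show "(\<lambda>n. norm (sqrt_iter B n x - Y x)) \<longlonglongrightarrow> 0"
        by (rule tendsto_norm_zero[OF LIM_zero[OF lim]])
    qed
    from tendsto_add[OF this lim[of "Y x"]]
    have "(\<lambda>n. sqrt_iter B n (sqrt_iter B n x)) \<longlonglongrightarrow> Y (Y x)" by simp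
    then have "(\<lambda>n. sqrt_iter B (Suc n) x) \<longlonglongrightarrow> (1/2) *\<^sub>R (B x + Y (Y x))"
      unfolding sqrt_iter.simps by (intro tendsto_intros)
    moreover have "(\<lambda>n. sqrt_iter B (Suc n) x) \<longlonglongrightarrow> Y x"
      using lim by (rule LIMSEQ_Suc)
    ultimately show ?thesis using LIMSEQ_unique by blast
  qed
  define S where "S = (\<lambda>x. x - Y x)"
  have symS: "symmetric_op S"
    using symmetric_op_diff[OF _ symY, of "\<lambda>x. x"]
    by (simp add: S_def symmetric_op_def bounded_linear_ident)
  have "positive_op S"
    unfolding positive_op_def
  proof (intro conjI allI symS)
    fix x
    have "re_inner x (Y x) \<le> norm x * norm x"
      using abs_re_inner_le[of x "Y x"] mult_left_mono[OF Y_le[of x] norm_ge_zero[of x]] by linarith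
    then show "0 \<le> re_inner x (S x)"
      by (simp add: S_def re_inner.diff_right re_inner_self power2_eq_square)
  qed
  moreover have "S (S x) = A x" for x
  proof -
    have "S (S x) = x - 2 *\<^sub>R Y x + Y (Y x)"
      by (simp add: S_def Y.diff scaleR_2)
    also have "2 *\<^sub>R Y x = B x + Y (Y x)" by (subst fixpoint) simp
    finally show ?thesis by (simp add: B_def)
  qed
  moreover have "Z (S x) = S (Z x)" if Z: "bounded_linear Z" "\<And>x. Z (A x) = A (Z x)" for Z x
  proof -
    have ZB: "Z (B x) = B (Z x)" for x
      using Z by (simp add: B_def linear_diff[OF bounded_linear.linear])
    have "(\<lambda>n. Z (sqrt_iter B n x)) \<longlonglongrightarrow> Z (Y x)"
      by (rule bounded_linear.tendsto[OF Z(1) lim])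
    moreover have "(\<lambda>n. Z (sqrt_iter B n x)) \<longlonglongrightarrow> Y (Z x)"
      using lim[of "Z x"]
      by (simp add: dominated_commute_with[where W = Z, OF dominated_sqrt_iter Z(1)] ZB)
    ultimately have "Z (Y x) = Y (Z x)" by (rule LIMSEQ_unique)
    then show ?thesis
      using Z by (simp add: S_def linear_diff[OF bounded_linear.linear])
  qed
  ultimately show ?thesis by blast
qed

text \<open>Dividing by a norm bound \<open>k\<close> reduces to contractions; the root is then
  multiplied by \<open>sqrt k\<close>.\<close>

lemma positive_sqrt_exists:
  fixes A :: "'a::complex_hilbert \<Rightarrow> 'a"
  assumes A: "positive_op A"
  shows "\<exists>S. positive_op S \<and> (\<forall>x. S (S x) = A x) \<and>
    (\<forall>Z. bounded_linear Z \<longrightarrow> (\<forall>x. Z (A x) = A (Z x)) \<longrightarrow> (\<forall>x. Z (S x) = S (Z x)))"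
proof -
  have linA: "bounded_linear A" using A by (simp add: positive_op_def symmetric_op_def)
  then obtain k where k: "k > 0" "\<And>x. norm (A x) \<le> norm x * k"
    using bounded_linear.pos_bounded by blast
  define A' where "A' = (\<lambda>x. (1 / k) *\<^sub>R A x)"
  have "positive_op A'" using A k by (auto simp: A'_def intro: positive_op_scaleR)
  moreover have "norm (A' x) \<le> norm x" for x using k by (simp add: A'_def field_simps)
  ultimately obtain S where S: "positive_op S" "\<And>x. S (S x) = A' x"
    "\<And>Z x. bounded_linear Z \<Longrightarrow> (\<forall>x. Z (A' x) = A' (Z x)) \<Longrightarrow> Z (S x) = S (Z x)"
    using positive_contraction_sqrt_exists[of A'] by metis
  have linS: "linear S"
    using S(1) by (simp add: positive_op_def symmetric_op_def bounded_linear.linear)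
  have "positive_op (\<lambda>x. sqrt k *\<^sub>R S x)" using S k by (auto intro: positive_op_scaleR)
  moreover have "sqrt k *\<^sub>R S (sqrt k *\<^sub>R S x) = A x" for x
    using k S(2) by (simp add: linear_scale[OF linS] A'_def)
  moreover have "Z (sqrt k *\<^sub>R S x) = sqrt k *\<^sub>R S (Z x)"
    if Z: "bounded_linear Z" "\<forall>x. Z (A x) = A (Z x)" for Z x
    using S(3)[OF Z(1)] Z(2) linear_scale[OF bounded_linear.linear[OF Z(1)]]
    by (simp add: A'_def)
  ultimately show ?thesis by (intro exI[of _ "\<lambda>x. sqrt k *\<^sub>R S x"]) blast
qed

text \<open>The constructed root \<open>Q\<close> commutes with any other root \<open>P\<close>,
  since \<open>P\<close> commutes with \<open>A\<close>. Hence \<open>P + Q\<close> kills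
  \<open>d = P x - Q x\<close>; both nonnegative forms vanish at \<open>d\<close>, so
  \<open>P - Q\<close> kills \<open>d\<close> as well, and symmetry gives
  \<open>d = 0\<close>.\<close>

lemma positive_sqrt_unique:
  fixes A :: "'a::complex_hilbert \<Rightarrow> 'a"
  assumes "positive_op R" "\<And>x. R (R x) = A x" "positive_op S" "\<And>x. S (S x) = A x"
  shows "R = S"
proof -
  have posA: "positive_op A"
    using positive_op_square[of R] assms(1,2) by (simp add: positive_op_def)
  obtain Q where Q: "positive_op Q" "\<And>x. Q (Q x) = A x"
    "\<And>Z x. bounded_linear Z \<Longrightarrow> (\<forall>x. Z (A x) = A (Z x)) \<Longrightarrow> Z (Q x) = Q (Z x)"
    using positive_sqrt_exists[OF posA] by metis
  have "P = Q" if P: "positive_op P" "\<And>x. P (P x) = A x" for P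
  proof
    fix x
    have lin: "bounded_linear P" "bounded_linear Q"
      using P Q by (auto simp: positive_op_def symmetric_op_def)
    interpret P: bounded_linear P by (rule lin)
    interpret Q: bounded_linear Q by (rule lin)
    have c: "P (Q x) = Q (P x)" for x
      by (rule Q(3)[OF lin(1)]) (simp flip: P(2))
    define d where "d = P x - Q x"
    have "P d + Q d = 0"
      by (simp add: d_def P.diff Q.diff P(2) Q(2) c)
    then have "re_inner d (P d) + re_inner d (Q d) = 0"
      by (simp flip: re_inner.add_right add: re_inner.zero_right)
    moreover have "0 \<le> re_inner d (P d)" "0 \<le> re_inner d (Q d)"
      using P Q by (auto simp: positive_op_def)
    ultimately have "P d = 0" "Q d = 0"
      using positive_op_eq_0[OF P(1), of d] positive_op_eq_0[OF Q(1), of d] by linarith+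
    then have "P d - Q d = 0" by simp
    moreover have "symmetric_op (\<lambda>x. P x - Q x)"
      using P(1) Q(1) by (intro symmetric_op_diff) (auto simp: positive_op_def)
    ultimately show "P x = Q x"
      using symmetric_op_square_eq_0[of "\<lambda>x. P x - Q x" x] by (simp add: d_def)
  qed
  then show ?thesis using assms by metis
qed

text \<open>For \<open>D = M - A\<close> and \<open>E = \<bar>D\<bar>\<close> the difference \<open>X = D - E\<close> satisfies \<open>X\<^sup>2 = 4 M X\<close>
  and \<open>X E = - 2 M X\<close>, so \<open>\<langle>Xy, E X y\<rangle> = - 2 \<langle>Xy, M X y\<rangle>\<close>. Both forms are nonnegative and hence
  vanish, which gives \<open>X = 0\<close>.\<close>

lemma le_of_square_eq:
  fixes A M :: "'a::complex_hilbert \<Rightarrow> 'a"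
  assumes M: "positive_op M" and A: "symmetric_op A"
    and sq: "\<And>x. M (M x) = A (A x)" and comm: "\<And>x. M (A x) = A (M x)"
  shows "positive_op (\<lambda>x. M x - A x)"
proof -
  define D where "D = (\<lambda>x. M x - A x)"
  have symM: "symmetric_op M" using M by (simp add: positive_op_def)
  have symD: "symmetric_op D" unfolding D_def by (intro symmetric_op_diff symM A)
  interpret A: bounded_linear A using A by (simp add: symmetric_op_def)
  interpret M: bounded_linear M using symM by (simp add: symmetric_op_def)
  interpret D: bounded_linear D using symD by (simp add: symmetric_op_def)
  obtain E where E: "positive_op E" "\<And>x. E (E x) = D (D x)"
    "\<And>Z x. bounded_linear Z \<Longrightarrow> (\<forall>x. Z (D (D x)) = D (D (Z x))) \<Longrightarrow> Z (E x) = E (Z x)"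
    using positive_sqrt_exists[OF positive_op_square[OF symD]] by metis
  have symE: "symmetric_op E" using E by (simp add: positive_op_def)
  interpret E: bounded_linear E using symE by (simp add: symmetric_op_def)
  have MD: "M (D x) = D (M x)" for x by (simp add: D_def M.diff comm)
  have ME: "M (E x) = E (M x)" for x by (rule E(3)) (simp_all add: M.bounded_linear_axioms MD)
  have DE: "D (E x) = E (D x)" for x by (rule E(3)) (simp_all add: D.bounded_linear_axioms)
  have DD: "D (D x) = 2 *\<^sub>R M (D x)" for x
    by (simp add: D_def M.diff A.diff comm sq scaleR_2)
  have norm_E: "norm (E x) = norm (D x)" for x
    using symmetric_op_norm_square[OF symE, of x] symmetric_op_norm_square[OF symD, of x] E(2) by simp
  \<comment> \<open>\<open>E\<close> and \<open>D\<close> produce equal norms at every vector, so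
    the factorisation \<open>D\<^sup>2 = 2 M D\<close> forces \<open>E D = 2 E M\<close>.\<close>
  have "norm (E (D x - 2 *\<^sub>R M x)) = 0" for x
    unfolding norm_E by (simp add: D.diff D.scaleR MD[symmetric] DD)
  then have ED: "E (D x) = 2 *\<^sub>R E (M x)" for x
    by (simp add: E.diff E.scaleR)
  define X where "X = (\<lambda>x. D x - E x)"
  have symX: "symmetric_op X" unfolding X_def by (intro symmetric_op_diff symD symE)
  have XX: "X (X x) = 4 *\<^sub>R M (X x)" for x
    by (simp add: X_def D.diff E.diff M.diff DE ED E(2) DD ME scaleR_diff_right)
      (simp add: algebra_simps flip: scaleR_add_left)
  have XE: "X (E x) = (-2) *\<^sub>R M (X x)" for x
    by (simp add: X_def M.diff DE ED E(2) DD ME scaleR_diff_right)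
  have EX: "E (X x) = X (E x)" for x
    by (simp add: X_def E.diff DE)
  have MX: "M (X x) = X (M x)" for x
    by (simp add: X_def M.diff MD ME)
  have zero: "X x = 0" for x
  proof -
    have "re_inner (X x) (E (X x)) = - 2 * re_inner (X x) (M (X x))"
      by (simp add: EX XE re_inner.scaleR_right re_inner.minus_right)
    moreover have "0 \<le> re_inner (X x) (E (X x))" "0 \<le> re_inner (X x) (M (X x))"
      using M E by (auto simp: positive_op_def)
    ultimately have "M (X (X x)) = 0"
      using positive_op_eq_0[OF M, of "X x"] by (simp add: MX XX)
    then have "X (X (X x)) = 0" by (simp only: XX[of "X x"] scaleR_zero_right)
    \<comment> \<open>The cube of a symmetric operator vanishes at \<open>x\<close>; its factors are
      cancelled one at a time.\<close>
    then show ?thesis using symmetric_op_square_eq_0[OF symX] by blast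
  qed
  then have "D x = E x" for x by (simp add: X_def)
  then show ?thesis using E(1) by (simp add: D_def)
qed

section \<open>Riesz representation and adjoints\<close>

text \<open>Minimising \<open>b (L y) (L y) - 2 f y\<close> over \<open>y\<close>: the values \<open>L y\<close> along a minimising
  sequence are Cauchy, and the Euler--Lagrange equation identifies their limit as \<open>w\<close>.\<close>

lemma coercive_form_representation:
  fixes b :: "'h::banach \<Rightarrow> 'h \<Rightarrow> real" and L :: "'e::real_vector \<Rightarrow> 'h" and f :: "'e \<Rightarrow> real"
  assumes bil: "bounded_bilinear b" and sym: "\<And>u v. b u v = b v u"
    and coer: "c > 0" "\<And>u. c * (norm u)\<^sup>2 \<le> b u u"
    and L: "linear L" and f: "linear f" and bound: "\<And>y. \<bar>f y\<bar> \<le> k * norm (L y)"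
  shows "\<exists>w. \<forall>y. f y = b w (L y)"
proof -
  interpret b: bounded_bilinear b by fact
  interpret L: linear L by fact
  interpret f: linear f by fact
  define J where "J = (\<lambda>y. b (L y) (L y) - 2 * f y)"
  \<comment> \<open>Completing the square: \<open>c * u\<^sup>2 - 2 * k * u\<close> is smallest at
    \<open>u = k / c\<close>, with value \<open>- (k\<^sup>2 / c)\<close>.\<close>
  have bdd: "- (k\<^sup>2 / c) \<le> J y" for y
  proof -
    have "0 \<le> (c * norm (L y) - k)\<^sup>2 / c" using coer(1) by simp
    also have "\<dots> = c * (norm (L y))\<^sup>2 - 2 * (k * norm (L y)) + k\<^sup>2 / c"
      using coer(1) by (simp add: power2_eq_square field_simps)
    finally show ?thesis using coer(2)[of "L y"] bound[of y] by (simp add: J_def abs_le_iff)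
  qed
  define m where "m = Inf (range J)"
  have bdd_below: "bdd_below (range J)" using bdd by (auto intro!: bdd_belowI)
  have m_le: "m \<le> J y" for y unfolding m_def by (rule cInf_lower[OF _ bdd_below]) simp
  have "\<exists>y. J y < m + 1 / real (Suc n)" for n
    using cInf_lessD[of "range J" "m + 1 / real (Suc n)"] by (auto simp: m_def)
  then obtain y where y: "J (y n) < m + 1 / real (Suc n)" for n by metis
  \<comment> \<open>The linear part of \<open>J\<close> cancels. As \<open>J\<close> is at least
    \<open>m\<close> at the midpoint, two values close to \<open>m\<close> leave little room for the
    last term.\<close>
  have parallelogram: "2 * J u + 2 * J v = 4 * J ((1/2) *\<^sub>R (u + v)) + b (L u - L v) (L u - L v)" for u v
    by (simp add: J_def L.add L.scale f.add f.scale b.add_left b.add_right b.diff_left b.diff_right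
        b.scaleR_left b.scaleR_right sym[of "L v" "L u"] field_simps)
  have dist_le: "c * (norm (L (y i) - L (y j)))\<^sup>2 \<le> 2 / real (Suc i) + 2 / real (Suc j)" for i j
    using parallelogram[of "y i" "y j"] y[of i] y[of j] m_le[of "(1/2) *\<^sub>R (y i + y j)"]
      coer(2)[of "L (y i) - L (y j)"] by simp
  have "Cauchy (\<lambda>n. L (y n))"
  proof (rule metric_CauchyI)
    fix e :: real assume e: "0 < e"
    obtain N where N: "inverse (real (Suc N)) < c * e\<^sup>2 / 4"
      using reals_Archimedean[of "c * e\<^sup>2 / 4"] coer(1) e by auto
    have "dist (L (y i)) (L (y j)) < e" if "i \<ge> N" "j \<ge> N" for i j
    proof -
      have "2 / real (Suc i) + 2 / real (Suc j) \<le> 2 / real (Suc N) + 2 / real (Suc N)"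
        using that by (intro add_mono divide_left_mono) auto
      also have "\<dots> < c * e\<^sup>2" using N divide_inverse[of 2 "real (Suc N)"] by linarith
      finally have "c * (norm (L (y i) - L (y j)))\<^sup>2 < c * e\<^sup>2"
        using dist_le[of i j] by linarith
      then have "(norm (L (y i) - L (y j)))\<^sup>2 < e\<^sup>2"
        using coer(1) by simp
      then show ?thesis
        unfolding dist_norm by (rule power_less_imp_less_base) (use e in simp)
    qed
    then show "\<exists>M. \<forall>m\<ge>M. \<forall>n\<ge>M. dist (L (y m)) (L (y n)) < e" by blast
  qed
  then obtain w where w: "(\<lambda>n. L (y n)) \<longlonglongrightarrow> w"
    using Cauchy_convergent convergent_def by metis
  have "f z = b w (L z)" for z
  proof -
    define d q where "d = b w (L z) - f z" and "q = b (L z) (L z)"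
    \<comment> \<open>Moving from \<open>y n\<close> to \<open>y n + s *\<^sub>R z\<close> can lower
      \<open>J\<close> by no more than its distance from the infimum, which tends to zero.\<close>
    have ineq: "0 \<le> 2 * s * d + s\<^sup>2 * q" for s
    proof -
      have "- (1 / real (Suc n)) \<le> 2 * s * (b (L (y n)) (L z) - f z) + s\<^sup>2 * q" for n
      proof -
        have "J (y n + s *\<^sub>R z) = J (y n) + (2 * s * (b (L (y n)) (L z) - f z) + s\<^sup>2 * q)"
          by (simp add: J_def L.add L.scale f.add f.scale b.add_left b.add_right
              b.scaleR_left b.scaleR_right sym[of "L z" "L (y n)"] q_def power2_eq_square algebra_simps)
        then show ?thesis using m_le[of "y n + s *\<^sub>R z"] y[of n] by linarith
      qed
      moreover have "(\<lambda>n. - (1 / real (Suc n))) \<longlonglongrightarrow> - 0"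
        by (intro tendsto_minus LIMSEQ_Suc[OF lim_1_over_n])
      moreover have "(\<lambda>n. 2 * s * (b (L (y n)) (L z) - f z) + s\<^sup>2 * q) \<longlonglongrightarrow> 2 * s * d + s\<^sup>2 * q"
        unfolding d_def by (intro tendsto_intros b.tendsto w)
      ultimately have "- 0 \<le> 2 * s * d + s\<^sup>2 * q"
        by (intro LIMSEQ_le) auto
      then show ?thesis by simp
    qed
    have "d = 0"
    proof (cases "q = 0")
      case True
      then show ?thesis using ineq[of "- d"] not_real_square_gt_zero[of d] zero_le_square[of d] by simp
    next
      case False
      then have "0 < q" using coer(1) coer(2)[of "L z"] unfolding q_def
        by (metis less_eq_real_def mult_nonneg_nonneg order_trans zero_le_power2)
      then have "2 * (- d / q) * d + (- d / q)\<^sup>2 * q = - (d\<^sup>2 / q)"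
        by (simp add: field_simps power2_eq_square)
      then have "d\<^sup>2 / q \<le> 0" using ineq[of "- d / q"] by simp
      then show ?thesis using \<open>0 < q\<close> by (simp add: divide_le_0_iff)
    qed
    then show ?thesis by (simp add: d_def)
  qed
  then show ?thesis by blast
qed

text \<open>With \<open>L\<close> the identity this is the Riesz theorem; with \<open>L\<close> a
  symmetric operator it detects the vectors in the range of \<open>L\<close>.\<close>

lemma re_inner_representation:
  fixes L :: "'e::real_vector \<Rightarrow> 'h::complex_hilbert" and f :: "'e \<Rightarrow> real"
  assumes "linear L" "linear f" "\<And>y. \<bar>f y\<bar> \<le> k * norm (L y)"
  shows "\<exists>w. \<forall>y. f y = re_inner w (L y)"
  using coercive_form_representation[OF bounded_bilinear_re_inner re_inner_commute, of 1 L f k] assms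
  by (simp add: re_inner_self)

section \<open>Functionals determined by their values and the Riesz theorem\<close>

lemma norm_pairing_le: "cmod \<langle>\<phi>, x\<rangle> \<le> norm \<phi> * norm x"
  by (simp add: pairing_def norm_adual.rep_eq norm_blinfun)

lemma adual_eqI:
  assumes "\<And>x. \<langle>\<phi>, x\<rangle> = \<langle>\<psi>, x\<rangle>"
  shows "\<phi> = \<psi>"
  using assms by (metis pairing_def complex_cnj_cancel_iff blinfun_eqI Rep_adual_inject)

lemma pairing_eqI_Re:
  assumes "\<And>x. Re \<langle>\<phi>, x\<rangle> = Re \<langle>\<psi>, x\<rangle>"
  shows "\<phi> = \<psi>"
proof (rule adual_eqI)
  fix x
  have "Im \<langle>\<theta>, x\<rangle> = - Re \<langle>\<theta>, \<i> *\<^sub>C x\<rangle>" for \<theta> :: "'a adual"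
    by (simp add: pairing_simps)
  then show "\<langle>\<phi>, x\<rangle> = \<langle>\<psi>, x\<rangle>" by (simp add: complex_eq_iff assms)
qed

text \<open>Ensures that \<open>inv riesz\<close> in \<open>hadj\<close> picks an actual
  preimage.\<close>

lemma surj_riesz: "surj (riesz :: 'a::complex_hilbert \<Rightarrow> 'a adual)"
  unfolding surj_def
proof
  fix \<phi> :: "'a adual"
  have "bounded_linear (\<lambda>x. Re \<langle>\<phi>, x\<rangle>)"
    by (rule bounded_linear_compose[OF bounded_linear_Re bounded_linear_pairing])
  moreover have "\<bar>Re \<langle>\<phi>, x\<rangle>\<bar> \<le> norm \<phi> * norm x" for x
    using abs_Re_le_cmod norm_pairing_le order_trans by blast
  ultimately obtain w where "\<And>x. Re \<langle>\<phi>, x\<rangle> = re_inner w x"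
    using re_inner_representation[of "\<lambda>x. x" "\<lambda>x. Re \<langle>\<phi>, x\<rangle>" "norm \<phi>"]
      bounded_linear.linear linear_ident by blast
  then have "\<phi> = riesz w" by (intro pairing_eqI_Re) (simp add: pairing_riesz re_inner_def)
  then show "\<exists>w. \<phi> = riesz w" ..
qed

section \<open>Adjoints in Hilbert space\<close>

lemma cinner_hadj:
  fixes A :: "'a::complex_hilbert \<Rightarrow> 'a"
  assumes "bounded_clinear A"
  shows "cinner (hadj A y) x = cinner y (A x)"
proof -
  have "riesz (hadj A y) = dual_op A (riesz y)"
    unfolding hadj_def by (rule surj_f_inv_f[OF surj_riesz])
  then show ?thesis using assms by (metis pairing_riesz pairing_dual_op)
qed

lemma cinner_hadj':
  fixes A :: "'a::complex_hilbert \<Rightarrow> 'a"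
  assumes "bounded_clinear A"
  shows "cinner y (hadj A x) = cinner (A y) x"
  using cinner_hadj[OF assms, of x y] by (metis cinner_commute)

lemma re_inner_hadj:
  fixes A :: "'a::complex_hilbert \<Rightarrow> 'a"
  assumes "bounded_clinear A"
  shows "re_inner y (hadj A x) = re_inner (A y) x"
  using cinner_hadj'[OF assms] by (simp add: re_inner_def)

lemma re_inner_scaleC_cnj: "re_inner (a *\<^sub>C x) y = re_inner x (cnj a *\<^sub>C y)"
proof -
  have "cinner (a *\<^sub>C x) y = cnj a * cinner x y"
    by (metis cinner_commute cinner_scaleC_right complex_cnj_mult)
  then show ?thesis by (simp add: re_inner_def cinner_scaleC_right)
qed

lemma bounded_clinear_hadj:
  fixes A :: "'a::complex_hilbert \<Rightarrow> 'a"
  assumes "bounded_clinear A"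
  shows "bounded_clinear (hadj A)"
proof (rule bounded_clinearI)
  note adj = re_inner_hadj[OF assms]
  have linA: "bounded_linear A" using assms by (simp add: bounded_clinear_def)
  obtain k where k: "k \<ge> 0" "\<And>x. norm (A x) \<le> norm x * k"
    using bounded_linear.nonneg_bounded[OF linA] by blast
  show "bounded_linear (hadj A)"
  proof (rule bounded_linear_intro)
    show "hadj A (x + y) = hadj A x + hadj A y" for x y
      by (rule re_inner_eqI) (simp add: adj re_inner.add_right)
    show "hadj A (r *\<^sub>R x) = r *\<^sub>R hadj A x" for r x
      by (rule re_inner_eqI) (simp add: adj re_inner.scaleR_right)
    show "norm (hadj A x) \<le> norm x * k" for x
    proof (cases "hadj A x = 0")
      case False
      have "norm (hadj A x) * norm (hadj A x) = re_inner (A (hadj A x)) x"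
        by (simp add: re_inner_self power2_eq_square flip: adj)
      also have "\<dots> \<le> norm (A (hadj A x)) * norm x"
        using abs_re_inner_le abs_le_D1 by blast
      also have "\<dots> \<le> (norm (hadj A x) * k) * norm x"
        by (intro mult_right_mono k) simp
      finally show ?thesis using False by (simp add: mult.assoc mult.commute)
    qed (simp add: k)
  qed
  show "hadj A (\<i> *\<^sub>C x) = \<i> *\<^sub>C hadj A x" for x
  proof (rule re_inner_eqI)
    fix z
    have "re_inner z (\<i> *\<^sub>C hadj A x) = re_inner (A ((-\<i>) *\<^sub>C z)) x"
      using re_inner_scaleC_cnj[of "-\<i>" z] by (simp flip: adj)
    also have "\<dots> = re_inner (A z) (\<i> *\<^sub>C x)"
      using assms re_inner_scaleC_cnj[of "-\<i>" "A z"] by (simp add: bounded_clinear_def)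
    finally show "re_inner z (hadj A (\<i> *\<^sub>C x)) = re_inner z (\<i> *\<^sub>C hadj A x)"
      by (simp add: adj)
  qed
qed

text \<open>The adjoint is already determined by real parts of inner products, so the real theory of
  symmetric operators applies.\<close>

lemma hselfadjoint_iff:
  fixes A :: "'a::complex_hilbert \<Rightarrow> 'a"
  shows "hselfadjoint A \<longleftrightarrow> bounded_clinear A \<and> symmetric_op A"
proof (cases "bounded_clinear A")
  case True
  then have "symmetric_op A \<longleftrightarrow> (\<forall>x y. re_inner x (hadj A y) = re_inner x (A y))"
    by (simp add: symmetric_op_def bounded_clinear_def re_inner_hadj)
  also have "\<dots> \<longleftrightarrow> hadj A = A"
  proof
    assume eq: "\<forall>x y. re_inner x (hadj A y) = re_inner x (A y)"
    show "hadj A = A" by (rule ext, rule re_inner_eqI) (simp add: eq)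
  qed simp
  finally show ?thesis using True by (simp add: hselfadjoint_def)
qed (simp add: hselfadjoint_def)

lemma nonneg_op_iff:
  fixes A :: "'a::complex_hilbert \<Rightarrow> 'a"
  shows "nonneg_op A \<longleftrightarrow> bounded_clinear A \<and> positive_op A"
  by (auto simp: nonneg_op_def hselfadjoint_iff positive_op_def re_inner_def)

section \<open>The operators \<open>sqrt_op\<close> and \<open>abs_op\<close>\<close>

text \<open>The real linear root commutes with multiplication by \<open>\<i>\<close> because
  \<open>A\<close> does, so it is complex linear; uniqueness then makes the definite description
  denote it.\<close>

lemma sqrt_op:
  fixes A :: "'a::complex_hilbert \<Rightarrow> 'a"
  assumes "nonneg_op A"
  shows "nonneg_op (sqrt_op A)" "sqrt_op A (sqrt_op A x) = A x"
    "bounded_linear Z \<Longrightarrow> (\<And>x. Z (A x) = A (Z x)) \<Longrightarrow> Z (sqrt_op A x) = sqrt_op A (Z x)"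
proof -
  have A: "bounded_clinear A" "positive_op A" using assms by (auto simp: nonneg_op_iff)
  obtain S where S: "positive_op S" "\<And>x. S (S x) = A x"
    "\<And>Z x. bounded_linear Z \<Longrightarrow> (\<forall>x. Z (A x) = A (Z x)) \<Longrightarrow> Z (S x) = S (Z x)"
    using positive_sqrt_exists[OF A(2)] by metis
  have "bounded_clinear S"
  proof (rule bounded_clinearI)
    show "bounded_linear S" using S(1) by (simp add: positive_op_def symmetric_op_def)
    show "S (\<i> *\<^sub>C x) = \<i> *\<^sub>C S x" for x
      using S(3)[OF bounded_linear_scaleC, of \<i>] A(1) by (simp add: bounded_clinear_def)
  qed
  then have "nonneg_op S" using S(1) by (simp add: nonneg_op_iff)
  moreover have "R = S" if "nonneg_op R \<and> R \<circ> R = A" for R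
    using that by (intro positive_sqrt_unique[OF _ _ S(1,2)]) (auto simp: nonneg_op_iff)
  ultimately have "sqrt_op A = S"
    unfolding sqrt_op_def using S(2) by (intro the_equality) auto
  then show "nonneg_op (sqrt_op A)" "sqrt_op A (sqrt_op A x) = A x"
    "bounded_linear Z \<Longrightarrow> (\<And>x. Z (A x) = A (Z x)) \<Longrightarrow> Z (sqrt_op A x) = sqrt_op A (Z x)"
    using \<open>nonneg_op S\<close> S by auto
qed

text \<open>\<open>A\<close> commutes with its square and hence with \<open>abs_op A\<close>, which
  is what the comparison \<open>le_of_square_eq\<close> asks for.\<close>

lemma abs_op:
  fixes A :: "'a::complex_hilbert \<Rightarrow> 'a"
  assumes "hselfadjoint A"
  shows "nonneg_op (abs_op A)" "abs_op A (abs_op A x) = A (A x)"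
    "positive_op (\<lambda>x. abs_op A x - A x)" "A (abs_op A x) = abs_op A (A x)"
proof -
  have A: "bounded_clinear A" "symmetric_op A" using assms by (auto simp: hselfadjoint_iff)
  then have "nonneg_op (A \<circ> A)"
    using positive_op_square[OF A(2)]
    by (auto simp: nonneg_op_iff bounded_clinear_def o_def positive_op_def symmetric_op_def)
  note sq = sqrt_op[OF this, folded abs_op_def, unfolded o_def]
  have lin: "bounded_linear A" using A by (simp add: bounded_clinear_def)
  show "nonneg_op (abs_op A)" "abs_op A (abs_op A x) = A (A x)"
    "A (abs_op A x) = abs_op A (A x)" for x
    using sq(1,2) sq(3)[OF lin] by auto
  then show "positive_op (\<lambda>x. abs_op A x - A x)"
    by (intro le_of_square_eq) (auto simp: nonneg_op_iff A(2))
qed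

section \<open>Finite-dimensional subspaces\<close>

text \<open>An orthonormal subset of \<open>L ` V\<close> is bounded and separated, and since \<open>k\<close> is bounded below
  on \<open>L ` V\<close> so is its image under the compact operator \<open>k\<close>. This bounds its cardinality, and an
  orthonormal set of maximal cardinality is a basis.\<close>

lemma finite_basis_if_compact_bounded_below:
  fixes b :: "'h::real_normed_vector \<Rightarrow> 'h \<Rightarrow> real" and L :: "'e::real_vector \<Rightarrow> 'h"
    and k :: "'h \<Rightarrow> 'z::real_normed_vector"
  assumes bil: "bounded_bilinear b" and sym: "\<And>u v. b u v = b v u"
    and coer: "c > 0" "\<And>u. c * (norm u)\<^sup>2 \<le> b u u"
    and L: "linear L" "inj L" and V: "subspace V"
    and k: "bounded_linear k" "compact (closure (k ` cball 0 1))"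
    and below: "\<And>v. v \<in> V \<Longrightarrow> norm (L v) \<le> a * norm (k (L v))"
  shows "\<exists>E. finite E \<and> E \<subseteq> V \<and> (\<forall>v\<in>V. v = (\<Sum>e\<in>E. b (L e) (L v) *\<^sub>R e))"
proof -
  interpret b: bounded_bilinear b by fact
  interpret L: linear L by fact
  interpret k: bounded_linear k by fact
  define orth where "orth = (\<lambda>E. finite E \<and> E \<subseteq> V \<and>
    (\<forall>e\<in>E. \<forall>e'\<in>E. b (L e) (L e') = (if e = e' then 1 else 0)))"
  obtain \<beta> where \<beta>: "\<beta> > 0" "\<And>u v. norm (b u v) \<le> norm u * norm v * \<beta>"
    using b.pos_bounded by blast
  \<comment> \<open>Radius bound: \<open>b (L e) (L e) = 1\<close> and coercivity give
    \<open>norm (L e) \<le> r\<close>.\<close>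
  define r where "r = sqrt (1 / c)"
  \<comment> \<open>Separation: distinct orthonormal \<open>e\<close>, \<open>e'\<close> have
    \<open>b (L (e - e')) (L (e - e')) = 2\<close>, so their images under \<open>k\<close> are at
    least \<open>\<delta>\<close> apart. The summand 1 avoids division by zero when
    \<open>a = 0\<close>.\<close>
  define \<delta> where "\<delta> = sqrt (2 / (\<beta> * (a\<^sup>2 + 1)))"
  have "0 < r" using coer(1) by (simp add: r_def)
  have a1: "0 < a\<^sup>2 + 1" by (simp add: add_nonneg_pos)
  then have "0 < \<delta>" using \<beta>(1) by (simp add: \<delta>_def)
  define g where "g = (\<lambda>e. k ((1 / r) *\<^sub>R L e))"
  have "compact (closure (k ` cball 0 1))" by fact
  \<comment> \<open>After scaling by \<open>1 / r\<close> the images are still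
    \<open>\<delta> / r\<close> apart, so a ball of half that radius contains at most one of
    them.\<close>
  then obtain P where P: "finite P" "closure (k ` cball 0 1) \<subseteq> (\<Union>x\<in>P. ball x (\<delta> / (2 * r)))"
    unfolding compact_eq_totally_bounded using \<open>0 < \<delta>\<close> \<open>0 < r\<close>
    by (meson divide_pos_pos mult_pos_pos zero_less_numeral)
  have card_le: "card E \<le> card P" if E: "orth E" for E
  proof -
    have "\<exists>x\<in>P. g e \<in> ball x (\<delta> / (2 * r))" if "e \<in> E" for e
    proof -
      have "b (L e) (L e) = 1" using E that by (simp add: orth_def)
      then have "(norm (L e))\<^sup>2 \<le> 1 / c" using coer(1) coer(2)[of "L e"] by (simp add: field_simps)
      then have "norm (L e) \<le> r" unfolding r_def by (rule real_le_rsqrt)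
      then have "(1 / r) *\<^sub>R L e \<in> cball 0 1" using \<open>0 < r\<close> by (simp add: field_simps)
      then have "g e \<in> closure (k ` cball 0 1)"
        unfolding g_def by (intro subsetD[OF closure_subset] imageI)
      then show ?thesis using P(2) by blast
    qed
    then obtain h where h: "\<And>e. e \<in> E \<Longrightarrow> h e \<in> P" "\<And>e. e \<in> E \<Longrightarrow> g e \<in> ball (h e) (\<delta> / (2 * r))"
      by metis
    have "inj_on h E"
    proof (rule inj_onI, rule ccontr)
      fix e e' assume e: "e \<in> E" "e' \<in> E" "h e = h e'" "e \<noteq> e'"
      have "dist (g e) (g e') < \<delta> / (2 * r) + \<delta> / (2 * r)"
        using h(2)[OF e(1)] h(2)[OF e(2)] e(3) dist_triangle3[of "g e" "g e'" "h e"] by simp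
      then have lt: "dist (g e) (g e') < \<delta> / r" using \<open>0 < r\<close> by simp
      have "g e - g e' = (1 / r) *\<^sub>R k (L (e - e'))"
        by (simp add: g_def k.scaleR k.diff L.diff scaleR_diff_right)
      then have "dist (g e) (g e') = norm (k (L (e - e'))) / r"
        using \<open>0 < r\<close> by (simp add: dist_norm)
      with lt have "norm (k (L (e - e'))) < \<delta>" using \<open>0 < r\<close> by (simp add: divide_less_cancel)
      then have "(norm (k (L (e - e'))))\<^sup>2 < \<delta>\<^sup>2" by (intro power_strict_mono) auto
      also have "\<delta>\<^sup>2 = 2 / (\<beta> * (a\<^sup>2 + 1))" using \<beta>(1) a1 by (simp add: \<delta>_def)
      finally have "(norm (k (L (e - e'))))\<^sup>2 * (\<beta> * (a\<^sup>2 + 1)) < 2"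
        using \<beta>(1) a1 by (simp add: pos_less_divide_eq)
      moreover have "2 \<le> (norm (k (L (e - e'))))\<^sup>2 * (\<beta> * (a\<^sup>2 + 1))"
      proof -
        have "2 = b (L (e - e')) (L (e - e'))"
          using E e by (simp add: orth_def L.diff b.diff_left b.diff_right)
        also have "\<dots> \<le> (norm (L (e - e')))\<^sup>2 * \<beta>"
          using \<beta>(2)[of "L (e - e')" "L (e - e')"] by (simp add: power2_eq_square)
        also have "\<dots> \<le> (a * norm (k (L (e - e'))))\<^sup>2 * \<beta>"
          using E e V \<beta>(1) by (intro mult_right_mono power_mono below subspace_diff) (auto simp: orth_def)
        also have "\<dots> \<le> (norm (k (L (e - e'))))\<^sup>2 * (\<beta> * (a\<^sup>2 + 1))"
          using \<beta>(1) by (simp add: algebra_simps power_mult_distrib)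
        finally show ?thesis .
      qed
      ultimately show False by simp
    qed
    then show ?thesis using h(1) P(1) by (intro card_inj_on_le[of h]) auto
  qed
  have "orth {}" by (simp add: orth_def)
  then obtain E where E: "orth E" and max: "\<And>E'. orth E' \<Longrightarrow> card E' \<le> card E"
    using ex_has_greatest_nat[of orth "{}" card "Suc (card P)"] card_le by (metis le_imp_less_Suc)
  have finE: "finite E" and EV: "E \<subseteq> V"
    and on: "\<And>e e'. e \<in> E \<Longrightarrow> e' \<in> E \<Longrightarrow> b (L e) (L e') = (if e = e' then 1 else 0)"
    using E by (auto simp: orth_def)
  have "v = (\<Sum>e\<in>E. b (L e) (L v) *\<^sub>R e)" if "v \<in> V" for v
  proof (rule ccontr)
    assume neq: "v \<noteq> (\<Sum>e\<in>E. b (L e) (L v) *\<^sub>R e)"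
    define u where "u = v - (\<Sum>e\<in>E. b (L e) (L v) *\<^sub>R e)"
    have "u \<in> V"
      unfolding u_def using V EV \<open>v \<in> V\<close>
      by (intro subspace_diff subspace_sum subspace_scale) auto
    have "u \<noteq> 0" using neq by (simp add: u_def)
    then have "L u \<noteq> 0" using L.inj_iff_eq_0 L(2) by blast
    have orthu: "b (L e) (L u) = 0" if "e \<in> E" for e
    proof -
      have "b (L e) (L u) = b (L e) (L v) - (\<Sum>e'\<in>E. b (L e') (L v) * b (L e) (L e'))"
        by (simp add: u_def L.diff L.sum L.scale b.diff_right b.sum_right b.scaleR_right)
      also have "(\<Sum>e'\<in>E. b (L e') (L v) * b (L e) (L e'))
          = (\<Sum>e'\<in>E. if e' = e then b (L e) (L v) else 0)"
        using that by (intro sum.cong) (auto simp: on)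
      also have "\<dots> = b (L e) (L v)" using that finE by simp
      finally show ?thesis by simp
    qed
    have pos: "0 < b (L u) (L u)"
      using coer(1) coer(2)[of "L u"] \<open>L u \<noteq> 0\<close>
      by (meson less_le_trans mult_pos_pos zero_less_norm_iff zero_less_power)
    define u' where "u' = (1 / sqrt (b (L u) (L u))) *\<^sub>R u"
    have u'V: "u' \<in> V" unfolding u'_def using V \<open>u \<in> V\<close> by (rule subspace_scale)
    have u'1: "b (L u') (L u') = 1"
      using pos by (simp add: u'_def L.scale b.scaleR_left b.scaleR_right)
    have u'0: "b (L e) (L u') = 0" "b (L u') (L e) = 0" if "e \<in> E" for e
      using orthu[OF that] sym by (simp_all add: u'_def L.scale b.scaleR_right b.scaleR_left)
    have "u' \<notin> E" using u'0 u'1 by fastforce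
    have "orth (insert u' E)"
      unfolding orth_def using finE EV u'V on u'1 u'0 \<open>u' \<notin> E\<close> by auto
    then have "card (insert u' E) \<le> card E" by (rule max)
    then show False using finE \<open>u' \<notin> E\<close> by simp
  qed
  then show ?thesis using finE EV by blast
qed

text \<open>By induction the combinations lie in a Minkowski sum of compact segments. This replaces
  Heine-Borel on the span of \<open>E\<close>.\<close>

lemma bounded_combinations_subset_compact:
  fixes E :: "'a::real_normed_vector set"
  assumes "finite E"
  shows "\<exists>K. compact K \<and> (\<forall>a. (\<forall>e\<in>E. \<bar>a e\<bar> \<le> m) \<longrightarrow> (\<Sum>e\<in>E. a e *\<^sub>R e) \<in> K)"
  using assms
proof (induction E rule: finite_induct)
  case empty
  show ?case by (intro exI[of _ "{0}"]) simp
next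
  case (insert e E)
  then obtain K where K: "compact K" "\<And>a. (\<forall>e\<in>E. \<bar>a e\<bar> \<le> m) \<Longrightarrow> (\<Sum>e\<in>E. a e *\<^sub>R e) \<in> K"
    by blast
  have "compact ((\<lambda>s. s *\<^sub>R e) ` {- m..m})"
    by (intro compact_continuous_image continuous_intros compact_Icc)
  then have "compact {x + y | x y. x \<in> (\<lambda>s. s *\<^sub>R e) ` {- m..m} \<and> y \<in> K}"
    by (rule compact_sums[OF _ K(1)])
  moreover have "(\<Sum>e'\<in>insert e E. a e' *\<^sub>R e') \<in> {x + y | x y. x \<in> (\<lambda>s. s *\<^sub>R e) ` {- m..m} \<and> y \<in> K}"
    if "\<forall>e'\<in>insert e E. \<bar>a e'\<bar> \<le> m" for a
  proof -
    have "a e *\<^sub>R e \<in> (\<lambda>s. s *\<^sub>R e) ` {- m..m}"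
      using that by (intro imageI) (auto simp: abs_le_iff)
    moreover have "(\<Sum>e\<in>E. a e *\<^sub>R e) \<in> K" using that by (intro K(2)) auto
    ultimately show ?thesis using insert.hyps by auto
  qed
  ultimately show ?case by blast
qed

text \<open>The unit sphere of \<open>V\<close> is compact, so \<open>norm (S v)\<close> attains a
  minimum there, positive by injectivity.\<close>

lemma injective_bounded_below_on_finite_basis:
  fixes S :: "'a::real_normed_vector \<Rightarrow> 'b::real_normed_vector" and f :: "'a \<Rightarrow> 'a \<Rightarrow> real"
  assumes S: "bounded_linear S" "\<And>v. v \<in> V \<Longrightarrow> S v = 0 \<Longrightarrow> v = 0"
    and V: "subspace V" "finite E" "E \<subseteq> V" "\<And>v. v \<in> V \<Longrightarrow> v = (\<Sum>e\<in>E. f e v *\<^sub>R e)"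
    and f: "\<And>e. bounded_linear (f e)"
  shows "\<exists>d>0. \<forall>v\<in>V. d * norm v \<le> norm (S v)"
proof -
  interpret S: bounded_linear S by fact
  define \<Sigma> where "\<Sigma> = {v\<in>V. norm v = 1}"
  have normalised: "(1 / norm v) *\<^sub>R v \<in> \<Sigma>" if "v \<in> V" "v \<noteq> 0" for v
    using that V(1) by (simp add: \<Sigma>_def subspace_scale)
  have "compact \<Sigma>"
  proof -
    \<comment> \<open>\<open>V\<close> is the fixed set of the continuous expansion map, which is
      why its unit sphere is closed.\<close>
    have "\<Sigma> = {v. v = (\<Sum>e\<in>E. f e v *\<^sub>R e) \<and> norm v = 1}"
    proof -
      have "(\<Sum>e\<in>E. f e v *\<^sub>R e) \<in> V" for v
        using V by (intro subspace_sum subspace_scale) auto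
      then show ?thesis using V(4) unfolding \<Sigma>_def by (metis (mono_tags, lifting))
    qed
    moreover have "closed {v. v = (\<Sum>e\<in>E. f e v *\<^sub>R e) \<and> norm v = 1}"
      by (intro closed_Collect_conj closed_Collect_eq continuous_intros
          linear_continuous_on[OF f])
    ultimately have closed: "closed \<Sigma>" by simp
    have "\<exists>m. \<forall>e\<in>E. \<forall>v. norm v = 1 \<longrightarrow> \<bar>f e v\<bar> \<le> m"
    proof -
      have "\<exists>m. \<forall>v. norm (f e v) \<le> norm v * m" for e :: 'a
        using bounded_linear.nonneg_bounded[OF f] by blast
      then obtain m where m: "\<And>e v. norm (f e v) \<le> norm v * m e" by metis
      show ?thesis
      proof (intro exI ballI allI impI)
        fix e v :: 'a assume "e \<in> E" "norm v = 1"
        then have "\<bar>f e v\<bar> \<le> \<bar>m e\<bar>" using m[of e v] by simp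
        also have "\<dots> \<le> (\<Sum>e\<in>E. \<bar>m e\<bar>)"
          using \<open>e \<in> E\<close> V(2) by (intro member_le_sum) auto
        finally show "\<bar>f e v\<bar> \<le> (\<Sum>e\<in>E. \<bar>m e\<bar>)" .
      qed
    qed
    then obtain m where m: "\<And>e v. e \<in> E \<Longrightarrow> norm v = 1 \<Longrightarrow> \<bar>f e v\<bar> \<le> m" by blast
    obtain K where K: "compact K" "\<And>a. (\<forall>e\<in>E. \<bar>a e\<bar> \<le> m) \<Longrightarrow> (\<Sum>e\<in>E. a e *\<^sub>R e) \<in> K"
      using bounded_combinations_subset_compact[OF V(2)] by blast
    have "\<Sigma> \<subseteq> K"
    proof
      fix v assume v: "v \<in> \<Sigma>"
      then have "(\<Sum>e\<in>E. f e v *\<^sub>R e) \<in> K" by (intro K(2)) (auto simp: \<Sigma>_def m)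
      then show "v \<in> K" using V(4)[of v] v by (simp add: \<Sigma>_def)
    qed
    then have "\<Sigma> = K \<inter> \<Sigma>" by blast
    then show ?thesis using compact_Int_closed[OF K(1) closed] by simp
  qed
  show ?thesis
  proof (cases "\<Sigma> = {}")
    case True
    then have "v = 0" if "v \<in> V" for v using normalised[OF that] by blast
    then show ?thesis by (intro exI[of _ 1]) (simp, metis norm_zero norm_ge_zero)
  next
    case False
    have "continuous_on \<Sigma> (\<lambda>v. norm (S v))"
      by (intro continuous_intros S.continuous_on continuous_on_id)
    then obtain v where v: "v \<in> \<Sigma>" "\<And>u. u \<in> \<Sigma> \<Longrightarrow> norm (S v) \<le> norm (S u)"
      using continuous_attains_inf[OF \<open>compact \<Sigma>\<close> False] by blast
    have "v \<noteq> 0" using v(1) by (auto simp: \<Sigma>_def)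
    then have "0 < norm (S v)" using v(1) S(2) by (auto simp: \<Sigma>_def)
    moreover have "norm (S v) * norm u \<le> norm (S u)" if "u \<in> V" for u
    proof (cases "u = 0")
      case False
      have "norm (S v) \<le> norm (S ((1 / norm u) *\<^sub>R u))"
        by (rule v(2)[OF normalised[OF that False]])
      then show ?thesis using False by (simp add: S.scaleR field_simps)
    qed (simp add: S.zero)
    ultimately show ?thesis by blast
  qed
qed

section \<open>The dual pairing\<close>

text \<open>Antilinearity survives norm limits, so the dual is closed in the complete space of
  bounded real linear maps.\<close>

instance adual :: (complex_normed_vector) banach
proof
  fix X :: "nat \<Rightarrow> 'a adual"
  assume X: "Cauchy X"
  have dist_Rep: "dist (Rep_adual f) (Rep_adual g) = dist f g" for f g :: "'a adual"
    by (simp add: dist_norm norm_adual.rep_eq minus_adual.rep_eq)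
  have "Cauchy (\<lambda>n. Rep_adual (X n))" using X by (simp add: Cauchy_def dist_Rep)
  then obtain f where f: "(\<lambda>n. Rep_adual (X n)) \<longlonglongrightarrow> f"
    using Cauchy_convergent convergent_def by metis
  have "blinfun_apply f (a *\<^sub>C x) = cnj a * blinfun_apply f x" for a x
  proof (rule LIMSEQ_unique)
    show "(\<lambda>n. blinfun_apply (Rep_adual (X n)) (a *\<^sub>C x)) \<longlonglongrightarrow> blinfun_apply f (a *\<^sub>C x)"
      by (intro blinfun.tendsto f tendsto_const)
    have "(\<lambda>n. cnj a * blinfun_apply (Rep_adual (X n)) x) \<longlonglongrightarrow> cnj a * blinfun_apply f x"
      by (intro tendsto_mult blinfun.tendsto f tendsto_const)
    then show "(\<lambda>n. blinfun_apply (Rep_adual (X n)) (a *\<^sub>C x)) \<longlonglongrightarrow> cnj a * blinfun_apply f x"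
      using Rep_adual[of "X _"] by simp
  qed
  then have "Rep_adual (Abs_adual f) = f" by (simp add: Abs_adual_inverse)
  then have "X \<longlonglongrightarrow> Abs_adual f"
    using f by (simp add: tendsto_iff flip: dist_Rep)
  then show "convergent X" by (rule convergentI)
qed

lemma bounded_bilinear_pairing: "bounded_bilinear (pairing :: 'a::complex_normed_vector adual \<Rightarrow> _)"
proof
  fix \<phi> \<psi> :: "'a adual" and x y :: 'a and r :: real
  show "\<langle>\<phi> + \<psi>, x\<rangle> = \<langle>\<phi>, x\<rangle> + \<langle>\<psi>, x\<rangle>" "\<langle>\<phi>, x + y\<rangle> = \<langle>\<phi>, x\<rangle> + \<langle>\<phi>, y\<rangle>"
    by (simp_all add: pairing_simps)
  show "\<langle>r *\<^sub>R \<phi>, x\<rangle> = r *\<^sub>R \<langle>\<phi>, x\<rangle>"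
    by (simp add: scaleR_eq_scaleC[of r \<phi>] pairing_simps scaleR_conv_of_real)
  show "\<langle>\<phi>, r *\<^sub>R x\<rangle> = r *\<^sub>R \<langle>\<phi>, x\<rangle>"
    by (simp add: scaleR_eq_scaleC[of r x] pairing_simps scaleR_conv_of_real)
  show "\<exists>K. \<forall>\<phi> x. norm \<langle>\<phi> :: 'a adual, x\<rangle> \<le> norm \<phi> * norm x * K"
    by (intro exI[of _ 1]) (simp add: norm_pairing_le)
qed

interpretation pairing: bounded_bilinear pairing
  by (rule bounded_bilinear_pairing)

lemma abs_Re_pairing_le: "\<bar>Re \<langle>\<phi>, x\<rangle>\<bar> \<le> norm \<phi> * norm x"
  using abs_Re_le_cmod norm_pairing_le order_trans by blast

lemma norm_adual_le:
  assumes "\<And>x. cmod \<langle>\<phi>, x\<rangle> \<le> k * norm x" "0 \<le> k"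
  shows "norm \<phi> \<le> k"
  unfolding norm_adual.rep_eq
  using assms by (intro norm_blinfun_bound) (simp_all add: pairing_def)

lemma bounded_bilinear_Re_pairing:
  fixes C :: "'a::real_normed_vector \<Rightarrow> 'b::complex_normed_vector"
  assumes "bounded_linear C"
  shows "bounded_bilinear (\<lambda>\<phi> \<psi>. Re \<langle>\<phi>, C \<psi>\<rangle>)"
proof -
  have "bounded_bilinear (\<lambda>\<phi> (x :: 'b). Re \<langle>\<phi>, x\<rangle>)"
    using abs_Re_pairing_le
    by unfold_locales (auto simp: pairing.add_left pairing.add_right pairing.scaleR_left
        pairing.scaleR_right intro!: exI[of _ 1])
  from bounded_bilinear.comp[OF this bounded_linear_ident assms] show ?thesis .
qed

lemma bounded_clinear_adj:
  fixes G :: "'x::complex_normed_vector \<Rightarrow> 'y::complex_inner"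
  assumes G: "bounded_clinear G"
  shows "bounded_clinear (adj G)"
proof (rule bounded_clinearI)
  note adj = pairing_adj[OF G]
  obtain k where k: "k \<ge> 0" "\<And>x. norm (G x) \<le> norm x * k"
    using bounded_linear.nonneg_bounded G unfolding bounded_clinear_def by blast
  show "bounded_linear (adj G)"
  proof (rule bounded_linear_intro)
    show "adj G (x + y) = adj G x + adj G y" for x y
      by (rule pairing_eqI_Re) (simp add: adj pairing_simps re_inner.add_left flip: re_inner_def)
    show "adj G (r *\<^sub>R x) = r *\<^sub>R adj G x" for r x
      by (rule pairing_eqI_Re) (simp add: adj pairing.scaleR_left re_inner.scaleR_left flip: re_inner_def)
    show "norm (adj G x) \<le> norm x * k" for x
    proof (rule norm_adual_le)
      fix z
      have "cmod \<langle>adj G x, z\<rangle> \<le> norm x * norm (G z)" by (simp add: adj norm_cinner_le)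
      also have "\<dots> \<le> norm x * (norm z * k)" by (intro mult_left_mono k) simp
      finally show "cmod \<langle>adj G x, z\<rangle> \<le> norm x * k * norm z" by (simp add: mult_ac)
    qed (simp add: k)
  qed
  show "adj G (\<i> *\<^sub>C x) = \<i> *\<^sub>C adj G x" for x
  proof (rule adual_eqI)
    fix z
    have "cinner (\<i> *\<^sub>C x) (G z) = - \<i> * cinner x (G z)"
      by (metis cinner_commute cinner_scaleC_right complex_cnj_mult complex_cnj_i)
    then show "\<langle>adj G (\<i> *\<^sub>C x), z\<rangle> = \<langle>\<i> *\<^sub>C adj G x, z\<rangle>"
      by (simp add: adj pairing_simps)
  qed
qed

text \<open>A vector in the kernel is orthogonal to the range of \<open>G\<close>, by continuity to
  its closure, and so to itself.\<close>

lemma inj_adj_dense_range: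
  fixes G :: "'x::complex_normed_vector \<Rightarrow> 'y::complex_inner"
  assumes G: "bounded_clinear G" and dense: "closure (range G) = UNIV"
  shows "inj (adj G)"
proof -
  have "linear (adj G)"
    using bounded_clinear_adj[OF G] by (simp add: bounded_clinear_def bounded_linear.linear)
  moreover have "y = 0" if y: "adj G y = 0" for y
  proof -
    have "re_inner y (G x) = 0" for x
      using pairing_adj[OF G, of y x] by (simp add: y pairing.zero_left re_inner_def)
    moreover have "closed {z. re_inner y z = 0}"
      by (intro closed_Collect_eq continuous_intros re_inner.continuous_on)
    ultimately have "closure (range G) \<subseteq> {z. re_inner y z = 0}"
      by (intro closure_minimal) auto
    then have "re_inner y y = 0" using dense by blast
    then show ?thesis by (simp add: re_inner_self)
  qed
  ultimately show ?thesis by (simp add: linear_inj_iff_eq_0)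
qed

section \<open>Real and imaginary parts of operators\<close>

lemma hselfadjoint_hRe:
  fixes A :: "'a::complex_hilbert \<Rightarrow> 'a"
  assumes A: "bounded_clinear A"
  shows "hselfadjoint (hRe A)"
proof -
  have lin: "bounded_linear A" "bounded_linear (hadj A)"
    using A bounded_clinear_hadj[OF A] by (auto simp: bounded_clinear_def)
  have eq: "hRe A = (\<lambda>y. (1/2) *\<^sub>R (A y + hadj A y))"
    by (simp add: fun_eq_iff hRe_def scaleR_eq_scaleC)
  have lin': "bounded_linear (hRe A)"
    unfolding eq by (intro bounded_linear_const_scaleR bounded_linear_add lin)
  moreover have "hRe A (\<i> *\<^sub>C x) = \<i> *\<^sub>C hRe A x" for x
    using A bounded_clinear_hadj[OF A]
    by (simp add: hRe_def bounded_clinear_def scaleC_add_right scaleC_scaleC)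
  ultimately have "bounded_clinear (hRe A)" by (intro bounded_clinearI)
  moreover have "re_inner (hRe A x) y = re_inner x (hRe A y)" for x y
    using re_inner_hadj[OF A, of y x] re_inner_hadj[OF A, of x y]
    by (simp add: eq re_inner.add_left re_inner.add_right re_inner.scaleR_left re_inner.scaleR_right
        re_inner_commute[of _ y] re_inner_commute[of "A y" x])
  ultimately show ?thesis using lin' by (simp add: hselfadjoint_iff symmetric_op_def)
qed

lemma hselfadjoint_hIm:
  fixes A :: "'a::complex_hilbert \<Rightarrow> 'a"
  assumes A: "bounded_clinear A"
  shows "hselfadjoint (hIm A)"
proof -
  have lin: "bounded_linear A" "bounded_linear (hadj A)"
    using A bounded_clinear_hadj[OF A] by (auto simp: bounded_clinear_def)
  have eq: "hIm A = (\<lambda>y. (1 / (2 * \<i>)) *\<^sub>C (A y - hadj A y))" by (simp add: fun_eq_iff hIm_def)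
  have lin': "bounded_linear (hIm A)"
    unfolding eq by (intro bounded_linear_compose[OF bounded_linear_scaleC] bounded_linear_sub lin)
  have sc: "A (a *\<^sub>C x) - hadj A (a *\<^sub>C x) = a *\<^sub>C (A x - hadj A x)" for a x
    using A bounded_clinear_hadj[OF A]
    by (simp add: bounded_clinear_def linear_diff[OF bounded_linear.linear[OF bounded_linear_scaleC]])
  have "hIm A (\<i> *\<^sub>C x) = \<i> *\<^sub>C hIm A x" for x
    by (simp add: eq sc scaleC_scaleC)
  with lin' have "bounded_clinear (hIm A)" by (intro bounded_clinearI)
  moreover have "re_inner (hIm A x) y = re_inner x (hIm A y)" for x y
  proof -
    \<comment> \<open>Conjugating \<open>1 / (2 * \<i>)\<close> changes its sign; exchanging
      \<open>A\<close> with its adjoint changes it back.\<close>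
    have "re_inner (hIm A x) y = re_inner (A x - hadj A x) ((- 1 / (2 * \<i>)) *\<^sub>C y)"
      unfolding eq by (subst re_inner_scaleC_cnj) simp
    also have "\<dots> = re_inner x (hadj A ((- 1 / (2 * \<i>)) *\<^sub>C y) - A ((- 1 / (2 * \<i>)) *\<^sub>C y))"
      using re_inner_hadj[OF A, of x] re_inner_hadj[OF A, of _ x]
      by (simp add: re_inner.diff_left re_inner.diff_right re_inner_commute[of "hadj A x"]
          re_inner_commute[of x "A _"])
    also have "\<dots> = re_inner x (- ((- 1 / (2 * \<i>)) *\<^sub>C (A y - hadj A y)))"
      by (simp only: sc[symmetric] minus_diff_eq)
    also have "- ((- 1 / (2 * \<i>)) *\<^sub>C (A y - hadj A y)) = hIm A y"
    proof -
      have "- v = (- 1 :: complex) *\<^sub>C v" for v :: 'a using scaleR_eq_scaleC[of "-1" v] by simp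
      then show ?thesis by (simp add: eq scaleC_scaleC)
    qed
    finally show ?thesis .
  qed
  ultimately show ?thesis using lin' by (simp add: hselfadjoint_iff symmetric_op_def)
qed

lemma re_inner_hIm:
  fixes A :: "'a::complex_hilbert \<Rightarrow> 'a"
  assumes A: "bounded_clinear A"
  shows "re_inner y (hIm A y) = Im (cinner y (A y))"
proof -
  have "cinner y (hadj A y) = cnj (cinner y (A y))"
    using cinner_hadj'[OF A] cinner_commute by metis
  then have "cinner y (A y - hadj A y) = cinner y (A y) - cnj (cinner y (A y))"
    by (metis add_diff_cancel_right' cinner_add_right diff_add_cancel)
  then have "cinner y (hIm A y) = (1 / (2 * \<i>)) * (cinner y (A y) - cnj (cinner y (A y)))"
    by (simp add: hIm_def cinner_scaleC_right)
  also have "\<dots> = of_real (Im (cinner y (A y)))"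
    by (simp add: complex_diff_cnj complex_eq_iff)
  finally show ?thesis by (simp add: re_inner_def)
qed

text \<open>The adjoint of \<open>G T G\<^sup>*\<close> is \<open>G T\<^sup>* G\<^sup>*\<close>,
  where reflexivity places the values of \<open>dadj T\<close> in the space itself.\<close>

lemma hRe_conjugate:
  fixes G :: "'x::complex_normed_vector \<Rightarrow> 'y::complex_hilbert" and T :: "'x adual \<Rightarrow> 'x"
  assumes refl: "reflexive_space TYPE('x)" and G: "bounded_clinear G" and T: "bounded_clinear T"
    and A: "bounded_clinear (\<lambda>y. G (T (adj G y)))"
  shows "hRe (\<lambda>y. G (T (adj G y))) y = G (dRe T (adj G y))"
proof -
  have "hadj (\<lambda>y. G (T (adj G y))) y = G (dadj T (adj G y))"
  proof (rule re_inner_eqI)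
    fix z
    have "re_inner z (hadj (\<lambda>y. G (T (adj G y))) y) = re_inner y (G (T (adj G z)))"
      by (simp add: re_inner_hadj[OF A] re_inner_commute)
    also have "\<dots> = Re \<langle>adj G y, T (adj G z)\<rangle>" by (simp add: re_inner_def pairing_adj[OF G])
    also have "\<dots> = Re \<langle>adj G z, dadj T (adj G y)\<rangle>" by (simp add: pairing_dadj[OF refl T])
    also have "\<dots> = re_inner z (G (dadj T (adj G y)))"
      by (simp add: re_inner_def pairing_adj[OF G])
    finally show "re_inner z (hadj (\<lambda>y. G (T (adj G y))) y) = re_inner z (G (dadj T (adj G y)))" .
  qed
  then show ?thesis
    using G by (simp add: hRe_def dRe_def bounded_clinear_def linear_add bounded_linear.linear)
qed

section \<open>Two-sided bounds for \<open>F_sharp\<close>\<close>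

text \<open>The coercive part of the form turns convergence of \<open>K (L y\<^sub>n)\<close> into norm convergence of a
  normalised minimising sequence \<open>L y\<^sub>n\<close>, because \<open>z \<mapsto> \<langle>z, M z\<rangle>\<close> is small on the differences
  \<open>y\<^sub>n - y\<^sub>m\<close> as soon as it is small on each \<open>y\<^sub>n\<close>.\<close>

lemma coercive_lower_bound:
  fixes L :: "'y::complex_inner \<Rightarrow> 'x::complex_normed_vector adual"
  assumes L: "linear L" and M: "positive_op M" and K: "compact_op K" and T: "bounded_linear T"
    and c: "c > 0" "\<And>y. c * (norm (L y))\<^sup>2 + Re \<langle>L y, K (L y)\<rangle> \<le> re_inner y (M y)"
    and pos: "\<And>\<phi>. \<phi> \<in> closure (range L) \<Longrightarrow> \<phi> \<noteq> 0 \<Longrightarrow> Im \<langle>\<phi>, T \<phi>\<rangle> > 0"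
  shows "\<exists>d>0. \<forall>y. d * (norm (L y))\<^sup>2 \<le> re_inner y (M y) + Im \<langle>L y, T (L y)\<rangle>"
proof (rule ccontr)
  assume contra: "\<not> ?thesis"
  interpret L: linear L by fact
  interpret T: bounded_linear T by fact
  interpret M: bounded_linear M using M by (simp add: positive_op_def symmetric_op_def)
  interpret K: bounded_linear K using K by (simp add: compact_op_def bounded_clinear_def)
  have M_nonneg: "0 \<le> re_inner y (M y)" for y using M by (simp add: positive_op_def)
  have T_nonneg: "0 \<le> Im \<langle>L y, T (L y)\<rangle>" for y
    using pos[of "L y"] closure_subset[of "range L"]
    by (cases "L y = 0") (auto simp: pairing.zero_left less_imp_le subset_iff)
  have "\<exists>z. norm (L z) = 1 \<and> re_inner z (M z) + Im \<langle>L z, T (L z)\<rangle> < inverse (real (Suc n))" for n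
  proof -
    have "0 < inverse (real (Suc n))" by simp
    then obtain y where y: "re_inner y (M y) + Im \<langle>L y, T (L y)\<rangle> < inverse (real (Suc n)) * (norm (L y))\<^sup>2"
      using contra by (meson not_le)
    then have "0 < inverse (real (Suc n)) * (norm (L y))\<^sup>2" using M_nonneg[of y] T_nonneg[of y] by linarith
    then have ne: "L y \<noteq> 0" by auto
    define z where "z = (1 / norm (L y)) *\<^sub>R y"
    have "re_inner z (M z) + Im \<langle>L z, T (L z)\<rangle>
        = (re_inner y (M y) + Im \<langle>L y, T (L y)\<rangle>) / (norm (L y))\<^sup>2"
      by (simp add: z_def L.scale M.scaleR T.scaleR pairing.scaleR_left pairing.scaleR_right
          re_inner.scaleR_left re_inner.scaleR_right power2_eq_square add_divide_distrib)
    also have "\<dots> < inverse (real (Suc n))" using y ne by (simp add: pos_divide_less_eq)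
    finally show ?thesis using ne by (intro exI[of _ z]) (simp add: z_def L.scale)
  qed
  then obtain z where z: "\<And>n. norm (L (z n)) = 1"
    "\<And>n. re_inner (z n) (M (z n)) + Im \<langle>L (z n), T (L (z n))\<rangle> < inverse (real (Suc n))" by metis
  have "\<forall>n. K (L (z n)) \<in> closure (K ` cball 0 1)"
    using z(1) by (auto intro!: subsetD[OF closure_subset])
  moreover have "seq_compact (closure (K ` cball 0 1))"
    using K by (simp add: compact_op_def compact_imp_seq_compact)
  ultimately obtain l r where r: "strict_mono r" "((\<lambda>n. K (L (z n))) \<circ> r) \<longlonglongrightarrow> l"
    by (meson seq_compactE)
  define y where "y = z \<circ> r"
  have y1: "norm (L (y n)) = 1" for n by (simp add: y_def z)
  have small: "re_inner (y n) (M (y n)) + Im \<langle>L (y n), T (L (y n))\<rangle> < inverse (real (Suc n))" for n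
  proof -
    have "inverse (real (Suc (r n))) \<le> inverse (real (Suc n))"
      using seq_suble[OF r(1), of n] by simp
    from less_le_trans[OF z(2)[of "r n"] this] show ?thesis by (simp add: y_def)
  qed
  have Cauchy_K: "Cauchy (\<lambda>n. K (L (y n)))"
    using LIMSEQ_imp_Cauchy[OF r(2)] by (simp add: y_def o_def)
  have "Cauchy (\<lambda>n. L (y n))"
  proof (rule metric_CauchyI)
    fix e :: real assume e: "0 < e"
    \<comment> \<open>With this threshold the form of \<open>M\<close> at a difference stays below
      \<open>c * e\<^sup>2 / 2\<close> and the compact term is at most
      \<open>c * e\<^sup>2 / 4\<close>, together less than \<open>c * e\<^sup>2\<close>.\<close>
    then have ce: "0 < c * e\<^sup>2 / 8" using c(1) by simp
    obtain N1 where N1: "inverse (real (Suc N1)) < c * e\<^sup>2 / 8"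
      using reals_Archimedean[OF ce] by blast
    obtain N2 where N2: "\<And>i j. i \<ge> N2 \<Longrightarrow> j \<ge> N2 \<Longrightarrow> dist (K (L (y i))) (K (L (y j))) < c * e\<^sup>2 / 8"
      using metric_CauchyD[OF Cauchy_K ce] by blast
    have "dist (L (y i)) (L (y j)) < e" if "i \<ge> max N1 N2" "j \<ge> max N1 N2" for i j
    proof -
      have inv: "inverse (real (Suc n)) < c * e\<^sup>2 / 8" if "n \<ge> max N1 N2" for n
      proof -
        have "inverse (real (Suc n)) \<le> inverse (real (Suc N1))" using that by simp
        then show ?thesis using N1 by linarith
      qed
      have M_small: "re_inner (y n) (M (y n)) < c * e\<^sup>2 / 8" if "n \<ge> max N1 N2" for n
        using small[of n] inv[OF that] T_nonneg[of "y n"] by linarith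
      \<comment> \<open>Parallelogram law for the nonnegative form of \<open>M\<close>; the term at
        the sum is dropped.\<close>
      have "re_inner (y i - y j) (M (y i - y j)) + re_inner (y i + y j) (M (y i + y j))
          = 2 * re_inner (y i) (M (y i)) + 2 * re_inner (y j) (M (y j))"
        by (simp add: M.diff M.add re_inner.diff_left re_inner.diff_right re_inner.add_left re_inner.add_right)
      then have "re_inner (y i - y j) (M (y i - y j)) < c * e\<^sup>2 / 2"
        using M_nonneg[of "y i + y j"] M_small[OF that(1)] M_small[OF that(2)] by linarith
      moreover have "c * (norm (L (y i - y j)))\<^sup>2 - norm (L (y i - y j)) * norm (K (L (y i - y j)))
          \<le> re_inner (y i - y j) (M (y i - y j))"
        using c(2)[of "y i - y j"] abs_Re_pairing_le[of "L (y i - y j)" "K (L (y i - y j))"] by linarith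
      moreover have "norm (L (y i - y j)) * norm (K (L (y i - y j))) \<le> 2 * (c * e\<^sup>2 / 8)"
      proof (rule mult_mono)
        show "norm (L (y i - y j)) \<le> 2"
          using norm_triangle_ineq4[of "L (y i)" "L (y j)"] y1 by (simp add: L.diff)
        show "norm (K (L (y i - y j))) \<le> c * e\<^sup>2 / 8"
          using N2[of i j] that by (simp add: L.diff K.diff dist_norm)
      qed auto
      ultimately have "c * (norm (L (y i - y j)))\<^sup>2 < c * e\<^sup>2"
        using ce by linarith
      then have "(norm (L (y i - y j)))\<^sup>2 < e\<^sup>2" using c(1) by simp
      then have "norm (L (y i - y j)) < e"
        by (rule power_less_imp_less_base) (use e in simp)
      then show ?thesis by (simp add: dist_norm L.diff)
    qed
    then show "\<exists>N. \<forall>i\<ge>N. \<forall>j\<ge>N. dist (L (y i)) (L (y j)) < e" by blast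
  qed
  then obtain \<phi> where \<phi>: "(\<lambda>n. L (y n)) \<longlonglongrightarrow> \<phi>"
    using Cauchy_convergent convergent_def by metis
  have "\<phi> \<in> closure (range L)"
    unfolding closure_sequential using \<phi> by (intro exI[of _ "\<lambda>n. L (y n)"]) simp
  moreover have "norm \<phi> = 1"
    using tendsto_norm[OF \<phi>] by (simp add: y1 LIMSEQ_const_iff)
  ultimately have "0 < Im \<langle>\<phi>, T \<phi>\<rangle>" by (intro pos) auto
  moreover have "Im \<langle>\<phi>, T \<phi>\<rangle> \<le> 0"
  proof (rule LIMSEQ_le)
    show "(\<lambda>n. Im \<langle>L (y n), T (L (y n))\<rangle>) \<longlonglongrightarrow> Im \<langle>\<phi>, T \<phi>\<rangle>"
      by (intro tendsto_Im pairing.tendsto T.tendsto \<phi>)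
    show "(\<lambda>n. inverse (real (Suc n))) \<longlonglongrightarrow> 0" by (rule LIMSEQ_inverse_real_of_nat)
    show "\<exists>N. \<forall>n\<ge>N. Im \<langle>L (y n), T (L (y n))\<rangle> \<le> inverse (real (Suc n))"
    proof (intro exI allI impI)
      show "Im \<langle>L (y n), T (L (y n))\<rangle> \<le> inverse (real (Suc n))" for n
        using small[of n] M_nonneg[of "y n"] by linarith
    qed
  qed
  ultimately show False by simp
qed

text \<open>The negative part \<open>B\<close> of \<open>A\<close> has finite rank: on the range of the square root \<open>S\<close> of \<open>B\<close> the form
  of \<open>A\<close> is nonpositive, so there the coercive part of the form is dominated by its compact part.
  Hence \<open>S\<close> is bounded below on its range, and \<open>\<parallel>S y\<parallel>\<close> is bounded by \<open>\<parallel>B y\<parallel> \<le> \<parallel>A y\<parallel>\<close>.\<close>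

lemma abs_op_upper_bound:
  fixes A :: "'y::complex_hilbert \<Rightarrow> 'y" and L :: "'y \<Rightarrow> 'x::complex_normed_vector adual"
  assumes A: "hselfadjoint A" and L: "bounded_linear L" "inj L"
    and C: "bounded_linear C" "\<And>\<phi> \<psi>. Re \<langle>\<phi>, C \<psi>\<rangle> = Re \<langle>\<psi>, C \<phi>\<rangle>"
    and c: "c > 0" "\<And>\<phi>. c * (norm \<phi>)\<^sup>2 \<le> Re \<langle>\<phi>, C \<phi>\<rangle>"
    and K: "compact_op K"
    and form: "\<And>y. re_inner y (A y) = Re \<langle>L y, C (L y)\<rangle> + Re \<langle>L y, K (L y)\<rangle>"
    and a: "\<And>y. norm (A y) \<le> a * norm (L y)"
  shows "\<exists>k. \<forall>y. re_inner y (abs_op A y) \<le> k * (norm (L y))\<^sup>2"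
proof -
  define M where "M = abs_op A"
  have symA: "symmetric_op A" using A by (simp add: hselfadjoint_iff)
  have M: "positive_op M" "\<And>x. M (M x) = A (A x)" "positive_op (\<lambda>x. M x - A x)"
    "\<And>x. A (M x) = M (A x)"
    using abs_op[OF A] by (auto simp: M_def nonneg_op_iff)
  have symM: "symmetric_op M" using M(1) by (simp add: positive_op_def)
  interpret A: bounded_linear A using symA by (simp add: symmetric_op_def)
  interpret M: bounded_linear M using symM by (simp add: symmetric_op_def)
  interpret L: bounded_linear L by fact
  define B where "B = (\<lambda>x. (1/2) *\<^sub>R (M x - A x))"
  define P where "P = (\<lambda>x. (1/2) *\<^sub>R (M x + A x))"
  have "positive_op B" unfolding B_def using M(3) by (intro positive_op_scaleR) auto
  then obtain S where S: "positive_op S" "\<And>x. S (S x) = B x" using positive_sqrt_exists by metis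
  have symS: "symmetric_op S" using S(1) by (simp add: positive_op_def)
  interpret S: bounded_linear S using symS by (simp add: symmetric_op_def)
  \<comment> \<open>The negative and positive parts annihilate each other because
    \<open>M\<^sup>2 = A\<^sup>2\<close> and \<open>M\<close> commutes with
    \<open>A\<close>.\<close>
  have BP: "B (P x) = 0" for x
    by (simp add: B_def P_def M.scaleR A.scaleR M.add A.add M(2,4))
  have SP: "S (P x) = 0" for x
    using symmetric_op_norm_square[OF symS, of "P x"] by (simp add: S(2) BP re_inner.zero_right)
  have PS: "P (S x) = 0" for x
  proof (rule re_inner_eqI)
    fix z
    have "re_inner z (P (S x)) = re_inner (P z) (S x)"
      using symmetric_opD(2)[OF symM, of z "S x"] symmetric_opD(2)[OF symA, of z "S x"]
      by (simp add: P_def re_inner.add_left re_inner.add_right re_inner.scaleR_left re_inner.scaleR_right)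
    also have "\<dots> = re_inner (S (P z)) x" by (rule symmetric_opD(2)[OF symS, symmetric])
    finally show "re_inner z (P (S x)) = re_inner z 0" by (simp add: SP re_inner.zero_left re_inner.zero_right)
  qed
  have A_eq: "A x = P x - B x" for x
    by (simp add: P_def B_def scaleR_diff_right scaleR_add_right flip: scaleR_add_left)
  have M_eq: "M x = A x + 2 *\<^sub>R B x" for x by (simp add: B_def)
  have AS: "re_inner (S x) (A (S x)) \<le> 0" for x
    using \<open>positive_op B\<close> by (simp add: A_eq PS re_inner.minus_right positive_op_def)
  have below: "norm (L v) \<le> (1 / c) * norm (K (L v))" if "v \<in> range S" for v
  proof (cases "L v = 0")
    case False
    have "c * (norm (L v))\<^sup>2 \<le> norm (L v) * norm (K (L v))"
    proof -
      have "re_inner v (A v) \<le> 0" using that AS by auto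
      then show ?thesis
        using form[of v] c(2)[of "L v"] abs_Re_pairing_le[of "L v" "K (L v)"] by linarith
    qed
    then show ?thesis using False c(1) by (simp add: power2_eq_square field_simps)
  qed (use c(1) in simp)
  have V: "subspace (range S)"
    using linear_subspace_image[OF S.linear_axioms subspace_UNIV] .
  have bil: "bounded_bilinear (\<lambda>\<phi> \<psi>. Re \<langle>\<phi>, C \<psi>\<rangle>)" by (rule bounded_bilinear_Re_pairing[OF C(1)])
  have K': "bounded_linear K" "compact (closure (K ` cball 0 1))"
    using K by (auto simp: compact_op_def bounded_clinear_def)
  \<comment> \<open>The basis is orthonormal for the form of \<open>C\<close> pulled back along
    \<open>L\<close>, so its coefficients are continuous in \<open>v\<close>.\<close>
  obtain E where E: "finite E" "E \<subseteq> range S"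
    "\<And>v. v \<in> range S \<Longrightarrow> v = (\<Sum>e\<in>E. Re \<langle>L e, C (L v)\<rangle> *\<^sub>R e)"
    using finite_basis_if_compact_bounded_below[OF bil C(2) c L.linear_axioms L(2) V K' below] by blast
  have "\<exists>d>0. \<forall>v\<in>range S. d * norm v \<le> norm (S v)"
  proof (rule injective_bounded_below_on_finite_basis[OF S.bounded_linear_axioms _ V E])
    show "bounded_linear (\<lambda>v. Re \<langle>L e, C (L v)\<rangle>)" for e
      by (rule bounded_linear_compose[OF bounded_bilinear.bounded_linear_right[OF bil] L(1)])
    show "v = 0" if "v \<in> range S" "S v = 0" for v
      using that symmetric_op_square_eq_0[OF symS] by auto
  qed
  \<comment> \<open>Applied to \<open>v = S x\<close>, where \<open>S v\<close> is
    \<open>B x\<close>.\<close>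
  then obtain d where d: "d > 0" "\<And>x. d * norm (S x) \<le> norm (B x)" by (auto simp: S(2))
  obtain \<beta> where \<beta>: "\<And>\<phi> \<psi>. norm (Re \<langle>\<phi>, C \<psi>\<rangle>) \<le> norm \<phi> * norm \<psi> * \<beta>"
    using bounded_bilinear.bounded[OF bil] by blast
  obtain \<kappa> where \<kappa>: "\<And>\<phi>. norm (K \<phi>) \<le> norm \<phi> * \<kappa>"
    using bounded_linear.bounded[OF K'(1)] by blast
  have "re_inner y (M y) \<le> (\<beta> + \<kappa> + 2 * (a / d)\<^sup>2) * (norm (L y))\<^sup>2" for y
  proof -
    have "re_inner y (M y) = re_inner y (A y) + 2 * re_inner y (B y)"
      by (simp add: M_eq re_inner.add_right re_inner.scaleR_right)
    also have "re_inner y (B y) = (norm (S y))\<^sup>2"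
      using symmetric_op_norm_square[OF symS] by (simp flip: S(2))
    also have "re_inner y (A y) \<le> (\<beta> + \<kappa>) * (norm (L y))\<^sup>2"
    proof -
      have "Re \<langle>L y, C (L y)\<rangle> \<le> norm (L y) * norm (L y) * \<beta>"
        using \<beta>[of "L y" "L y"] by (simp add: abs_le_iff)
      moreover have "Re \<langle>L y, K (L y)\<rangle> \<le> norm (L y) * norm (K (L y))"
        using abs_Re_pairing_le[of "L y" "K (L y)"] by simp
      moreover have "norm (L y) * norm (K (L y)) \<le> norm (L y) * (norm (L y) * \<kappa>)"
        by (intro mult_left_mono \<kappa>) simp
      ultimately show ?thesis by (simp add: form power2_eq_square algebra_simps)
    qed
    also have "(norm (S y))\<^sup>2 \<le> (a / d)\<^sup>2 * (norm (L y))\<^sup>2"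
    proof -
      \<comment> \<open>Equal squares of symmetric operators give equal norms, so half the
        difference \<open>M y - A y\<close> is no longer than \<open>A y\<close>.\<close>
      have "norm (M y) = norm (A y)"
        using symmetric_op_norm_square[OF symM, of y] symmetric_op_norm_square[OF symA, of y] M(2) by simp
      then have "norm (B y) \<le> norm (A y)"
        using norm_triangle_ineq4[of "M y" "A y"] by (simp add: B_def)
      then have "d * norm (S y) \<le> a * norm (L y)" using d(2)[of y] a[of y] by linarith
      then have "norm (S y) \<le> (a / d) * norm (L y)" using d(1) by (simp add: field_simps)
      then show ?thesis by (simp flip: power_mult_distrib add: power_mono)
    qed
    finally show ?thesis by (simp add: algebra_simps)
  qed
  then show ?thesis unfolding M_def by blast
qed

text \<open>Each inclusion turns a norm bound into a representing vector:
  \<open>re_inner (G x)\<close> is represented through \<open>S\<close>, and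
  \<open>y \<mapsto> re_inner w (S y)\<close> through \<open>adj G\<close> with the form of
  \<open>C\<close> as inner product.\<close>

lemma range_eq_if_norm_equivalent:
  fixes G :: "'x::complex_normed_vector \<Rightarrow> 'y::complex_hilbert" and C :: "'x adual \<Rightarrow> 'x"
  assumes G: "bounded_clinear G" and S: "symmetric_op S"
    and C: "bounded_linear C" "\<And>\<phi> \<psi>. Re \<langle>\<phi>, C \<psi>\<rangle> = Re \<langle>\<psi>, C \<phi>\<rangle>"
    and c: "c > 0" "\<And>\<phi>. c * (norm \<phi>)\<^sup>2 \<le> Re \<langle>\<phi>, C \<phi>\<rangle>"
    and lower: "\<And>y. norm (adj G y) \<le> k * norm (S y)"
    and upper: "\<And>y. norm (S y) \<le> k' * norm (adj G y)"
  shows "range G = range S"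
proof (intro subset_antisym image_subsetI)
  have linS: "bounded_linear S" using S by (simp add: symmetric_op_def)
  have linG: "linear (adj G)"
    using bounded_clinear_adj[OF G] by (simp add: bounded_clinear_def bounded_linear.linear)
  have adj: "re_inner y (G x) = Re \<langle>adj G y, x\<rangle>" for x y
    by (simp add: re_inner_def pairing_adj[OF G])
  show "G x \<in> range S" for x
  proof -
    have "\<bar>re_inner (G x) y\<bar> \<le> (norm x * k) * norm (S y)" for y
    proof -
      have "\<bar>re_inner (G x) y\<bar> \<le> norm x * norm (adj G y)"
        using abs_Re_pairing_le[of "adj G y" x] by (simp add: adj re_inner_commute[of "G x"] mult.commute)
      also have "\<dots> \<le> norm x * (k * norm (S y))" by (intro mult_left_mono lower) simp
      finally show ?thesis by (simp add: mult.assoc)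
    qed
    then obtain w where w: "\<And>y. re_inner (G x) y = re_inner w (S y)"
      using re_inner_representation[of S "re_inner (G x)"] linS
        bounded_linear.linear re_inner.bounded_linear_right by metis
    have "G x = S w"
      by (rule re_inner_eqI) (simp add: re_inner_commute[of _ "G x"] w re_inner_commute[of _ "S w"]
          symmetric_opD(2)[OF S])
    then show ?thesis by simp
  qed
  show "S w \<in> range G" for w
  proof -
    have "\<bar>re_inner w (S y)\<bar> \<le> (norm w * k') * norm (adj G y)" for y
    proof -
      have "\<bar>re_inner w (S y)\<bar> \<le> norm w * norm (S y)" by (rule abs_re_inner_le)
      also have "\<dots> \<le> norm w * (k' * norm (adj G y))" by (intro mult_left_mono upper) simp
      finally show ?thesis by (simp add: mult.assoc)
    qed
    moreover have "linear (\<lambda>y. re_inner w (S y))"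
      by (intro bounded_linear.linear bounded_linear_compose[OF re_inner.bounded_linear_right linS])
    ultimately obtain \<phi> where \<phi>: "\<And>y. re_inner w (S y) = Re \<langle>\<phi>, C (adj G y)\<rangle>"
      using coercive_form_representation[OF bounded_bilinear_Re_pairing[OF C(1)] C(2) c linG] by blast
    \<comment> \<open>Symmetry of \<open>C\<close> moves it onto \<open>\<phi>\<close>, which yields
      the explicit preimage \<open>C \<phi>\<close> under \<open>G\<close>.\<close>
    have "S w = G (C \<phi>)"
      by (rule re_inner_eqI)
        (simp add: adj C(2)[of _ \<phi>] re_inner_commute[of _ "S w"] symmetric_opD(2)[OF S] flip: \<phi>)
    then show ?thesis by simp
  qed
qed

theorem theorem3p1:
  fixes \<iota> :: "'x::complex_banach \<Rightarrow> 'u::complex_hilbert"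
    and F :: "'y::complex_hilbert \<Rightarrow> 'y"
    and G :: "'x \<Rightarrow> 'y"
    and T :: "'x adual \<Rightarrow> 'x"
    and t :: real
  assumes "reflexive_space TYPE('x)"
    and "gelfand_triple \<iota>"
    and "bounded_clinear F" and "bounded_clinear G" and "bounded_clinear T"
    and "F = G \<circ> T \<circ> adj G"
    and "compact_op G" and "closure (range G) = UNIV"
    and "t \<in> {0..2 * pi}"
    and "\<exists>C K. dRe (\<lambda>\<phi>. exp (\<i> * complex_of_real t) *\<^sub>C T \<phi>) = (\<lambda>\<phi>. C \<phi> + K \<phi>)
           \<and> compact_op K \<and> dselfadjoint C \<and> coercive C"
    and "\<And>\<phi>. \<phi> \<in> closure (range (adj G)) \<Longrightarrow> \<phi> \<noteq> 0 \<Longrightarrow> Im \<langle>\<phi>, T \<phi>\<rangle> > 0"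
  shows "nonneg_op (F_sharp t F) \<and> range G = range (sqrt_op (F_sharp t F))"
proof -
  note refl = assms(1) and F = assms(3) and G = assms(4) and T = assms(5)
    and F_eq = assms(6) and dense = assms(8) and ImT = assms(11)
  define \<omega> where "\<omega> = exp (\<i> * complex_of_real t)"
  obtain C K where CK: "dRe (\<lambda>\<phi>. \<omega> *\<^sub>C T \<phi>) = (\<lambda>\<phi>. C \<phi> + K \<phi>)"
    and K: "compact_op K" and saC: "dselfadjoint C" and "coercive C"
    using assms(10) unfolding \<omega>_def by blast
  then obtain c where c: "c > 0" "\<And>\<phi>. c * (norm \<phi>)\<^sup>2 \<le> Re \<langle>\<phi>, C \<phi>\<rangle>"
    by (auto simp: coercive_def)
  have "bounded_clinear C" "dadj C = C" using saC by (auto simp: dselfadjoint_def)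
  then have C: "bounded_linear C" "Re \<langle>\<phi>, C \<psi>\<rangle> = Re \<langle>\<psi>, C \<phi>\<rangle>" for \<phi> \<psi>
    using pairing_dadj[OF refl \<open>bounded_clinear C\<close>, of \<phi> \<psi>] by (auto simp: bounded_clinear_def)
  have linK: "bounded_linear K" using K by (simp add: compact_op_def bounded_clinear_def)
  have linG: "bounded_linear G" and linT: "bounded_linear T"
    using G T by (auto simp: bounded_clinear_def)
  have L: "bounded_linear (adj G)" "inj (adj G)"
    using bounded_clinear_adj[OF G] inj_adj_dense_range[OF G dense] by (auto simp: bounded_clinear_def)
  define A where "A = hRe (\<lambda>z. \<omega> *\<^sub>C F z)"
  have clin: "bounded_clinear (\<lambda>x. \<omega> *\<^sub>C H x)" if "bounded_clinear H"
    for H :: "'a::complex_normed_vector \<Rightarrow> 'b::complex_normed_vector"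
    using that by (auto simp: bounded_clinear_def scaleC_scaleC mult.commute
        intro: bounded_linear_compose[OF bounded_linear_scaleC])
  \<comment> \<open>The phase is moved inside so that the real part of the conjugated operator is
    computed with \<open>\<omega>\<close> times \<open>T\<close>.\<close>
  have \<omega>F: "(\<lambda>z. \<omega> *\<^sub>C F z) = (\<lambda>z. G (\<omega> *\<^sub>C T (adj G z)))"
    using G by (simp add: F_eq bounded_clinear_def)
  have A: "hselfadjoint A" unfolding A_def by (rule hselfadjoint_hRe[OF clin[OF F]])
  have A_eq: "A y = G (C (adj G y) + K (adj G y))" for y
    unfolding A_def \<omega>F
    using hRe_conjugate[OF refl G clin[OF T]] clin[OF F] by (simp add: CK \<omega>F)
  have form: "re_inner y (A y) = Re \<langle>adj G y, C (adj G y)\<rangle> + Re \<langle>adj G y, K (adj G y)\<rangle>" for y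
    by (simp add: re_inner_def A_eq pairing.add_right flip: pairing_adj[OF G])
  define M where "M = abs_op A"
  have M: "nonneg_op M" and MA: "positive_op (\<lambda>x. M x - A x)"
    using abs_op[OF A] by (auto simp: M_def)
  have Fs: "F_sharp t F = (\<lambda>y. M y + hIm F y)"
    by (simp add: fun_eq_iff F_sharp_def M_def A_def \<omega>_def)
  have form_Im: "re_inner y (hIm F y) = Im \<langle>adj G y, T (adj G y)\<rangle>" for y
    by (simp add: re_inner_hIm[OF F] pairing_adj[OF G]) (simp add: F_eq)
  have Im_nonneg: "0 \<le> Im \<langle>adj G y, T (adj G y)\<rangle>" for y
    using ImT[of "adj G y"] closure_subset[of "range (adj G)"]
    by (cases "adj G y = 0") (auto simp: pairing.zero_left less_imp_le subset_iff)
  have nonneg: "nonneg_op (F_sharp t F)"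
  proof -
    have "bounded_clinear (hIm F)" "symmetric_op (hIm F)"
      using hselfadjoint_hIm[OF F] by (auto simp: hselfadjoint_iff)
    then show ?thesis
      using M Im_nonneg unfolding Fs nonneg_op_iff positive_op_def symmetric_op_def bounded_clinear_def
      by (auto simp: bounded_linear_add scaleC_add_right re_inner.add_left re_inner.add_right form_Im)
  qed
  define S where "S = sqrt_op (F_sharp t F)"
  have S: "symmetric_op S"
    using sqrt_op(1)[OF nonneg] by (simp add: S_def nonneg_op_iff positive_op_def)
  have norm_S: "(norm (S y))\<^sup>2 = re_inner y (M y) + Im \<langle>adj G y, T (adj G y)\<rangle>" for y
    using symmetric_op_norm_square[OF S, of y] sqrt_op(2)[OF nonneg, of y]
    by (simp add: S_def Fs re_inner.add_right form_Im)
  obtain d where d: "d > 0"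
    "\<And>y. d * (norm (adj G y))\<^sup>2 \<le> re_inner y (M y) + Im \<langle>adj G y, T (adj G y)\<rangle>"
  proof -
    \<comment> \<open>Coercivity of \<open>C\<close> bounds the form of \<open>A\<close> from below,
      and \<open>A \<le> M\<close> transfers this to \<open>M\<close>.\<close>
    have "c * (norm (adj G y))\<^sup>2 + Re \<langle>adj G y, K (adj G y)\<rangle> \<le> re_inner y (M y)" for y
    proof -
      have "0 \<le> re_inner y (M y - A y)" using MA by (simp add: positive_op_def)
      then show ?thesis using c(2)[of "adj G y"] form[of y] by (simp add: re_inner.diff_right)
    qed
    then show ?thesis
      using coercive_lower_bound[OF bounded_linear.linear[OF L(1)] _ K linT c(1) _ ImT, of M] M that
      by (auto simp: nonneg_op_iff)
  qed
  obtain k where k: "\<And>y. re_inner y (M y) \<le> k * (norm (adj G y))\<^sup>2"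
  proof -
    \<comment> \<open>\<open>A\<close> factors as this operator after \<open>adj G\<close>, so its
      bound serves as the constant \<open>a\<close>.\<close>
    have "bounded_linear (\<lambda>\<phi>. G (C \<phi> + K \<phi>))"
      by (intro bounded_linear_compose[OF linG] bounded_linear_add C linK)
    then obtain a where "\<And>\<phi>. norm (G (C \<phi> + K \<phi>)) \<le> norm \<phi> * a"
      using bounded_linear.bounded by blast
    then have "norm (A y) \<le> a * norm (adj G y)" for y by (simp add: A_eq mult.commute)
    then show ?thesis
      using abs_op_upper_bound[OF A L C c K form] that by (auto simp: M_def)
  qed
  obtain \<tau> where \<tau>: "\<tau> \<ge> 0" "\<And>\<phi>. norm (T \<phi>) \<le> norm \<phi> * \<tau>"
    using bounded_linear.nonneg_bounded[OF linT] by blast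
  have "range G = range S"
  proof (rule range_eq_if_norm_equivalent[OF G S C c])
    show "norm (adj G y) \<le> (1 / sqrt d) * norm (S y)" for y
    proof -
      have "(sqrt d * norm (adj G y))\<^sup>2 \<le> (norm (S y))\<^sup>2"
        using d by (simp add: norm_S power_mult_distrib)
      then have "sqrt d * norm (adj G y) \<le> norm (S y)" by (rule power2_le_imp_le) simp
      then show ?thesis using d(1) by (simp add: field_simps)
    qed
    \<comment> \<open>The sign of \<open>k\<close> is unknown; \<open>\<bar>k\<bar>\<close> keeps
      the argument of the root nonnegative.\<close>
    show "norm (S y) \<le> sqrt (\<bar>k\<bar> + \<tau>) * norm (adj G y)" for y
    proof (rule power2_le_imp_le)
      have "Im \<langle>adj G y, T (adj G y)\<rangle> \<le> norm (adj G y) * norm (T (adj G y))"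
        using abs_Im_le_cmod norm_pairing_le abs_le_D1 order_trans by metis
      also have "\<dots> \<le> norm (adj G y) * (norm (adj G y) * \<tau>)" by (intro mult_left_mono \<tau>) simp
      finally have "Im \<langle>adj G y, T (adj G y)\<rangle> \<le> \<tau> * (norm (adj G y))\<^sup>2"
        by (simp add: power2_eq_square mult_ac)
      moreover have "k * (norm (adj G y))\<^sup>2 \<le> \<bar>k\<bar> * (norm (adj G y))\<^sup>2"
        by (intro mult_right_mono) auto
      ultimately have "(norm (S y))\<^sup>2 \<le> (\<bar>k\<bar> + \<tau>) * (norm (adj G y))\<^sup>2"
        using k[of y] by (simp add: norm_S distrib_right)
      then show "(norm (S y))\<^sup>2 \<le> (sqrt (\<bar>k\<bar> + \<tau>) * norm (adj G y))\<^sup>2"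
        using \<tau>(1) by (simp add: power_mult_distrib)
    qed (use \<tau>(1) in simp)
  qed
  with nonneg show ?thesis by (simp add: S_def)
qed

end
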